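(* The representation $\rho_0$ is not an algebraic limit of representations in $\mathcal U_2$: there is no sequence $(\rho_j)$ in $\mathcal U_2$ with $\rho_j(\gamma)\to\rho_0(\gamma)$ for every $\gamma\in F_2$. Thus, although $\mathcal U_2$ is Zariski dense in $X_2=\mathrm{Hom}(F_2,\mathrm{PSL}(3,\mathbb C))$, it is not dense in $\mathcal K_2$ for algebraic convergence.
   Context: $F_2$ is the free group on $x_1,x_2$; $X_2=\mathrm{Hom}(F_2,\mathrm{PSL}(3,\mathbb C))\simeq\mathrm{PSL}(3,\mathbb C)^2$. A sequence $\rho_j:F_2\to\mathrm{PSL}(3,\mathbb C)$ converges algebraically to $\rho$ if $\rho_j(\gamma)\to\rho(\gamma)$ for every $\gamma\in F_2$; this is convergence in the usual complex topology of $X_2$. The representation $\rho_0$. Let $U$ be a neighborhood of the identity in $\mathrm{PSL}(3,\mathbb C)$ such that, for every discrete subgroup $\Delta\subset\mathrm{PSL}(3,\mathbb C)$, the subgroup generated by $\Delta\cap U$ is nilpotent (a Zassenhaus neighborhood, known to exist). For $t>0$ let $a_t=[\mathrm{diag}(e^t,e^{-t},1)]$ and $b_t=[\mathrm{diag}(1,e^t,e^{-t})]$ in $\mathrm{PSL}(3,\mathbb C)$. Fix $t>0$ so small that $a_t,b_t\in U$ and define $\rho_0(x_1)=a_t$, $\rho_0(x_2)=b_t$. Kulkarni limit set of a discrete $G\subset\mathrm{PSL}(3,\mathbb C)$ acting on $\mathbb P^2_{\mathbb C}$: $L_0(G)$ is the closure of the set of points with infinite stabilizer; $L_1(G)$ is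 the closure of the set of accumulation points of orbits $Gz$, $z\notin L_0(G)$; $L_2(G)$ is the closure of the set of accumulation points of the families $\{g(K)\}_{g\in G}$ with $K$ compact in $\mathbb P^2_{\mathbb C}\setminus(L_0(G)\cup L_1(G))$. $\Lambda_{\mathrm{Kul}}(G)=L_0\cup L_1\cup L_2$, $\Omega_{\mathrm{Kul}}(G)=\mathbb P^2_{\mathbb C}\setminus\Lambda_{\mathrm{Kul}}(G)$. A complex Kleinian group is a discrete subgroup with $\Omega_{\mathrm{Kul}}(G)\neq\varnothing$. $\mathcal K_2\subset X_2$ is the set of representations whose image is a non-virtually-cyclic complex Kleinian group. $\mathcal U_2\subset X_2$ is the Schottky locus: a fixed nonempty subset of $X_2$, open in the usual complex topology, such that every $\rho\in\mathcal U_2$ is injective and $\rho(F_2)$ is a discrete, strongly irreducible, $\theta$-divergent complex Kleinian group, of Schottky type (the elements $\rho(x_i)^{\pm1}$ are proximal and play ping–pong on $\mathbb P^2_{\mathbb C}$), with $\nu(\rho(F_2))=\infty$. Here: strongly irreducible means that no finite-index subgroup preserves a point or a projective line of $\mathbb P^2_{\mathbb C}$; $\theta$-divergent means that for every sequence of pairwise distinct elements both gaps $\lambda_1-\lambda_2$ and $\lambda_2-\lambda_3$ of the logarithms $\lambda_1\ge\lambda_2\ge\lambda_3$ of the singular values (of $\mathrm{SL}(3,\mathbb C)$ lifts) tend to $+\infty$; $\nu(G)$ is the supremum of cardinalities of families of projective lines contained in $\Lambda_{\mathrm{Kul}}(G)$ with no three concurrent. *)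

theory Defs
  imports "HOL-Analysis.Analysis" "HOL-Algebra.Elementary_Groups"
begin

section \<open>The group PSL(3,C) and its action on the complex projective plane\<close>

text \<open>Matrices of determinant one up to a scalar; such a scalar is a cube root of unity.\<close>

definition SL3 :: "(complex^3^3) set" where
  "SL3 = {A. det A = 1}"

definition psl_rel :: "complex^3^3 \<Rightarrow> complex^3^3 \<Rightarrow> bool" where
  "psl_rel A B \<longleftrightarrow> A \<in> SL3 \<and> B \<in> SL3 \<and> (\<exists>c. B = (\<chi> i j. c * A $ i $ j))"

lemma psl_rel_refl: "A \<in> SL3 \<Longrightarrow> psl_rel A A"
  unfolding psl_rel_def by (auto intro!: exI[of _ 1] simp: vec_eq_iff)

lemma scalar_matrix_mult: "(\<chi> i j. c * (A::complex^3^3) $ i $ j) = mat c ** A"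
  by (simp add: vec_eq_iff matrix_matrix_mult_def mat_def forall_3 sum_3)

lemma mat_commute: "mat c ** (A::complex^3^3) = A ** mat c"
  by (simp add: vec_eq_iff matrix_matrix_mult_def mat_def forall_3 sum_3)

lemma mat_mult_mat: "mat c ** mat d = (mat (c * d) :: complex^3^3)"
  by (simp add: vec_eq_iff matrix_matrix_mult_def mat_def forall_3 sum_3)

lemma psl_rel_iff: "psl_rel A B \<longleftrightarrow> A \<in> SL3 \<and> B \<in> SL3 \<and> (\<exists>c. B = mat c ** A)"
  by (simp add: psl_rel_def scalar_matrix_mult)

lemma psl_rel_scalar_nonzero:
  assumes "B = mat c ** (A::complex^3^3)" "B \<in> SL3" shows "c \<noteq> 0"
proof
  assume "c = 0"
  have "det B = det (mat c :: complex^3^3) * det A"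
    by (simp only: assms(1) det_mul)
  also have "det (mat c :: complex^3^3) = 0"
    using \<open>c = 0\<close> by (simp add: det_3 mat_def)
  finally show False
    using assms(2) by (simp add: SL3_def)
qed

lemma psl_rel_part_equivp: "part_equivp psl_rel"
proof (rule part_equivpI)
  show "\<exists>A. psl_rel A A"
    by (rule exI[of _ "mat 1"], rule psl_rel_refl) (simp add: SL3_def)
  show "symp psl_rel"
  proof (rule sympI)
    fix A B assume "psl_rel A B"
    then obtain c where c: "A \<in> SL3" "B \<in> SL3" "B = mat c ** A"
      unfolding psl_rel_iff by blast
    have "c \<noteq> 0" using psl_rel_scalar_nonzero c by blast
    then have "A = mat (1 / c * c) ** A" by simp
    also have "\<dots> = mat (1 / c) ** B"
      by (simp only: c(3) matrix_mul_assoc mat_mult_mat)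
    finally have "A = mat (1 / c) ** B" .
    then show "psl_rel B A" using c unfolding psl_rel_iff by blast
  qed
  show "transp psl_rel"
  proof (rule transpI)
    fix A B C assume "psl_rel A B" "psl_rel B C"
    then obtain c d where cd: "A \<in> SL3" "C \<in> SL3" "B = mat c ** A" "C = mat d ** B"
      unfolding psl_rel_iff by blast
    have "C = mat (d * c) ** A"
      by (simp only: cd(3,4) matrix_mul_assoc mat_mult_mat)
    then show "psl_rel A C" using cd unfolding psl_rel_iff by blast
  qed
qed

quotient_type psl3 = "complex^3^3" / partial: psl_rel
  by (rule psl_rel_part_equivp)

lift_definition psl3_mult :: "psl3 \<Rightarrow> psl3 \<Rightarrow> psl3" is "\<lambda>A B. A ** B"
proof -
  fix A A' B B' assume "psl_rel A A'" "psl_rel B B'"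
  then obtain c d where cd: "A \<in> SL3" "A' \<in> SL3" "A' = mat c ** A"
      "B \<in> SL3" "B' \<in> SL3" "B' = mat d ** B"
    unfolding psl_rel_iff by blast
  have "A' ** B' = mat (c * d) ** (A ** B)"
  proof -
    have "A' ** B' = mat c ** (A ** mat d) ** B"
      by (simp only: cd(3,6) matrix_mul_assoc)
    also have "A ** mat d = mat d ** A"
      by (simp only: mat_commute)
    finally show ?thesis
      by (simp only: matrix_mul_assoc mat_mult_mat)
  qed
  moreover have "A ** B \<in> SL3" "A' ** B' \<in> SL3"
    using cd(1,2,4,5) by (simp_all add: SL3_def det_mul)
  ultimately show "psl_rel (A ** B) (A' ** B')"
    unfolding psl_rel_iff by blast
qed

lift_definition psl3_one :: psl3 is "mat 1"
  by (rule psl_rel_refl) (simp add: SL3_def)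

definition PSL3 :: "psl3 monoid" where
  "PSL3 = \<lparr>carrier = UNIV, mult = psl3_mult, one = psl3_one\<rparr>"

text \<open>The complex topology: the quotient topology from SL(3,C).\<close>

instantiation psl3 :: topological_space
begin

definition open_psl3 :: "psl3 set \<Rightarrow> bool" where
  "open_psl3 V \<longleftrightarrow> openin (top_of_set SL3) {A \<in> SL3. abs_psl3 A \<in> V}"

instance
proof
  show "open (UNIV :: psl3 set)"
    by (simp add: open_psl3_def)
  show "open (V \<inter> W)" if "open V" "open W" for V W :: "psl3 set"
  proof -
    have "{A \<in> SL3. abs_psl3 A \<in> V \<inter> W} =
        {A \<in> SL3. abs_psl3 A \<in> V} \<inter> {A \<in> SL3. abs_psl3 A \<in> W}" by auto
    then show ?thesis using that by (simp only: open_psl3_def openin_Int)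
  qed
  show "open (\<Union>K)" if "\<forall>V\<in>K. open V" for K :: "psl3 set set"
  proof -
    have "{A \<in> SL3. abs_psl3 A \<in> \<Union>K} = (\<Union>V\<in>K. {A \<in> SL3. abs_psl3 A \<in> V})" by auto
    moreover have "openin (top_of_set SL3) (\<Union>V\<in>K. {A \<in> SL3. abs_psl3 A \<in> V})"
      using that unfolding open_psl3_def by (intro openin_Union) auto
    ultimately show ?thesis by (simp only: open_psl3_def)
  qed
qed

end

definition proj_rel :: "complex^3 \<Rightarrow> complex^3 \<Rightarrow> bool" where
  "proj_rel u v \<longleftrightarrow> u \<noteq> 0 \<and> v \<noteq> 0 \<and> (\<exists>c. v = c *s u)"

quotient_type cp2 = "complex^3" / partial: proj_rel
proof (rule part_equivpI)
  show "\<exists>v. proj_rel v v"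
    unfolding proj_rel_def by (intro exI[of _ "1"] conjI exI[of _ 1]) simp_all
  show "symp proj_rel"
  proof (rule sympI)
    fix u v assume "proj_rel u v"
    then obtain c where c: "u \<noteq> 0" "v \<noteq> 0" "v = c *s u"
      unfolding proj_rel_def by blast
    then have "u = (1 / c) *s v" by (auto simp: vector_smult_assoc)
    then show "proj_rel v u" using c unfolding proj_rel_def by blast
  qed
  show "transp proj_rel"
    unfolding proj_rel_def by (rule transpI) (metis vector_smult_assoc)
qed

instantiation cp2 :: topological_space
begin

definition open_cp2 :: "cp2 set \<Rightarrow> bool" where
  "open_cp2 V \<longleftrightarrow> open {v. v \<noteq> 0 \<and> abs_cp2 v \<in> V}"

instance
proof
  have "{v::complex^3. v \<noteq> 0 \<and> abs_cp2 v \<in> UNIV} = - {0}" by auto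
  then show "open (UNIV :: cp2 set)"
    by (simp add: open_cp2_def open_Compl)
  show "open (V \<inter> W)" if "open V" "open W" for V W :: "cp2 set"
  proof -
    have "{v. v \<noteq> 0 \<and> abs_cp2 v \<in> V \<inter> W} =
        {v. v \<noteq> 0 \<and> abs_cp2 v \<in> V} \<inter> {v. v \<noteq> 0 \<and> abs_cp2 v \<in> W}" by auto
    then show ?thesis using that by (simp only: open_cp2_def open_Int)
  qed
  show "open (\<Union>K)" if "\<forall>V\<in>K. open V" for K :: "cp2 set set"
  proof -
    have "{v. v \<noteq> 0 \<and> abs_cp2 v \<in> \<Union>K} = (\<Union>V\<in>K. {v. v \<noteq> 0 \<and> abs_cp2 v \<in> V})" by auto
    moreover have "open (\<Union>V\<in>K. {v. v \<noteq> 0 \<and> abs_cp2 v \<in> V})"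
      using that unfolding open_cp2_def by (intro open_UN) auto
    ultimately show ?thesis by (simp only: open_cp2_def)
  qed
qed

end

lift_definition act :: "psl3 \<Rightarrow> cp2 \<Rightarrow> cp2" is "\<lambda>A v. A *v v"
proof -
  fix A B :: "complex^3^3" and u v :: "complex^3"
  assume "psl_rel A B" "proj_rel u v"
  then obtain c d where cd: "A \<in> SL3" "B \<in> SL3" "B = mat c ** A"
      "u \<noteq> 0" "v \<noteq> 0" "v = d *s u"
    unfolding psl_rel_iff proj_rel_def by blast
  have nz: "M *v w \<noteq> 0" if "M \<in> SL3" "w \<noteq> 0" for M :: "complex^3^3" and w
  proof -
    have "invertible M" using that(1) by (simp add: SL3_def invertible_det_nz)
    then obtain N where "N ** M = mat 1" unfolding invertible_def by blast
    then have "N *v (M *v w) = w" by (simp add: matrix_vector_mul_assoc)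
    then show ?thesis using that(2) by auto
  qed
  have "mat c *v w = c *s w" for w :: "complex^3"
    by (simp add: vec_eq_iff matrix_vector_mult_def mat_def forall_3 sum_3)
  then have "B *v v = c *s (A *v (d *s u))"
    by (simp add: cd(3,6) flip: matrix_vector_mul_assoc)
  also have "\<dots> = (c * d) *s (A *v u)"
    by (simp add: vec_eq_iff matrix_vector_mult_def sum_distrib_left mult_ac)
  finally show "proj_rel (A *v u) (B *v v)"
    using nz cd unfolding proj_rel_def by blast
qed

definition proj_line :: "cp2 set \<Rightarrow> bool" where
  "proj_line L \<longleftrightarrow>
    (\<exists>l::complex^3. l \<noteq> 0 \<and> L = {abs_cp2 v |v. v \<noteq> 0 \<and> (\<Sum>i\<in>UNIV. l $ i * v $ i) = 0})"

section \<open>Groups\<close>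

definition subgp :: "('a, 'b) monoid_scheme \<Rightarrow> 'a set \<Rightarrow> ('a, 'b) monoid_scheme" where
  "subgp G H = G\<lparr>carrier := H\<rparr>"

primrec lower_central :: "('a, 'b) monoid_scheme \<Rightarrow> nat \<Rightarrow> 'a set" where
  "lower_central G 0 = carrier G"
| "lower_central G (Suc n) = generate G
     {x \<otimes>\<^bsub>G\<^esub> y \<otimes>\<^bsub>G\<^esub> inv\<^bsub>G\<^esub> x \<otimes>\<^bsub>G\<^esub> inv\<^bsub>G\<^esub> y |x y. x \<in> lower_central G n \<and> y \<in> carrier G}"

definition nilpotent_group :: "('a, 'b) monoid_scheme \<Rightarrow> bool" where
  "nilpotent_group G \<longleftrightarrow> (\<exists>n. lower_central G n = {\<one>\<^bsub>G\<^esub>})"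

definition finite_index :: "('a, 'b) monoid_scheme \<Rightarrow> 'a set \<Rightarrow> bool" where
  "finite_index G H \<longleftrightarrow> subgroup H G \<and> finite (rcosets\<^bsub>G\<^esub> H)"

definition virtually_cyclic :: "('a, 'b) monoid_scheme \<Rightarrow> bool" where
  "virtually_cyclic G \<longleftrightarrow> (\<exists>H. finite_index G H \<and> cyclic_group (subgp G H))"

definition discrete_subgroup :: "psl3 set \<Rightarrow> bool" where
  "discrete_subgroup G \<longleftrightarrow> subgroup G PSL3 \<and> discrete G"

text \<open>Neighborhoods are taken to be open.\<close>

definition zassenhaus_nbhd :: "psl3 set \<Rightarrow> bool" where
  "zassenhaus_nbhd U \<longleftrightarrow> open U \<and> \<one>\<^bsub>PSL3\<^esub> \<in> U \<and>
    (\<forall>\<Delta>. discrete_subgroup \<Delta> \<longrightarrow> nilpotent_group (subgp PSL3 (generate PSL3 (\<Delta> \<inter> U))))"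

section \<open>The free group of rank two and its representations\<close>

text \<open>A letter is a generator together with the sign of its exponent (\<open>True\<close> for \<open>+1\<close>).\<close>

datatype gen = X1 | X2

type_synonym letter = "gen \<times> bool"

fun inv_letter :: "letter \<Rightarrow> letter" where
  "inv_letter (x, e) = (x, \<not> e)"

inductive cancels :: "letter list \<Rightarrow> letter list \<Rightarrow> bool" where
  "cancels (u @ [s, inv_letter s] @ v) (u @ v)"

quotient_type f2 = "letter list" / "equivclp cancels"
  by (rule equivp_evquivclp)

lemma cancels_context: "cancels u v \<Longrightarrow> cancels (a @ u @ b) (a @ v @ b)"
proof (induction rule: cancels.induct)
  case (1 u s v)
  show ?case using cancels.intros[of "a @ u" s "v @ b"] by simp
qed

lemma equivclp_cancels_context:
  assumes "equivclp cancels u v" shows "equivclp cancels (a @ u @ b) (a @ v @ b)"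
  using assms
proof (induction rule: equivclp_induct)
  case (step y z)
  have "equivclp cancels (a @ y @ b) (a @ z @ b)"
    using step(2) cancels_context r_into_equivclp converse_r_into_equivclp by metis
  with step(3) show ?case by (rule equivclp_trans)
qed simp

lift_definition f2_mult :: "f2 \<Rightarrow> f2 \<Rightarrow> f2" is "(@)"
proof -
  fix u u' v v' assume "equivclp cancels u u'" "equivclp cancels v v'"
  then have "equivclp cancels (u @ v) (u' @ v)" "equivclp cancels (u' @ v) (u' @ v')"
    using equivclp_cancels_context[of u u' "[]" v] equivclp_cancels_context[of v v' u' "[]"]
    by simp_all
  then show "equivclp cancels (u @ v) (u' @ v')" by (rule equivclp_trans)
qed

lift_definition f2_one :: f2 is "[]" .

definition F2 :: "f2 monoid" where
  "F2 = \<lparr>carrier = UNIV, mult = f2_mult, one = f2_one\<rparr>"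

definition f2_letter :: "letter \<Rightarrow> f2" where
  "f2_letter s = abs_f2 [s]"

abbreviation x1 :: f2 where "x1 \<equiv> f2_letter (X1, True)"
abbreviation x2 :: f2 where "x2 \<equiv> f2_letter (X2, True)"

definition Rep2 :: "(f2 \<Rightarrow> psl3) set" where
  "Rep2 = hom F2 PSL3"

definition alg_converges :: "(nat \<Rightarrow> f2 \<Rightarrow> psl3) \<Rightarrow> (f2 \<Rightarrow> psl3) \<Rightarrow> bool" where
  "alg_converges \<rho> \<rho>' \<longleftrightarrow> (\<forall>\<gamma>. (\<lambda>j. \<rho> j \<gamma>) \<longlonglongrightarrow> \<rho>' \<gamma>)"

text \<open>The usual complex topology on \<open>Rep2\<close>, transported from \<open>PSL(3,C) \<times> PSL(3,C)\<close>.\<close>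

definition open_Rep2 :: "(f2 \<Rightarrow> psl3) set \<Rightarrow> bool" where
  "open_Rep2 S \<longleftrightarrow> S \<subseteq> Rep2 \<and> open ((\<lambda>\<rho>. (\<rho> x1, \<rho> x2)) ` S)"

text \<open>
  Polynomial functions in the entries of two matrices. The affine variety PSL(3,C) is the
  quotient of SL(3,C) by the group of cube roots of unity, so its regular functions are the
  functions whose pullback to SL(3,C) is polynomial.
\<close>

inductive poly_fun :: "(complex^3^3 \<Rightarrow> complex^3^3 \<Rightarrow> complex) \<Rightarrow> bool" where
  "poly_fun (\<lambda>A B. c)"
| "poly_fun (\<lambda>A B. A $ i $ j)"
| "poly_fun (\<lambda>A B. B $ i $ j)"
| "poly_fun p \<Longrightarrow> poly_fun q \<Longrightarrow> poly_fun (\<lambda>A B. p A B + q A B)"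
| "poly_fun p \<Longrightarrow> poly_fun q \<Longrightarrow> poly_fun (\<lambda>A B. p A B * q A B)"

definition regular_on_Rep2 :: "((f2 \<Rightarrow> psl3) \<Rightarrow> complex) \<Rightarrow> bool" where
  "regular_on_Rep2 f \<longleftrightarrow> (\<exists>p. poly_fun p \<and>
    (\<forall>\<rho>\<in>Rep2. \<forall>A\<in>SL3. \<forall>B\<in>SL3. \<rho> x1 = abs_psl3 A \<and> \<rho> x2 = abs_psl3 B \<longrightarrow> f \<rho> = p A B))"

definition zariski_closed :: "(f2 \<Rightarrow> psl3) set \<Rightarrow> bool" where
  "zariski_closed Z \<longleftrightarrow>
    (\<exists>\<F>. (\<forall>f\<in>\<F>. regular_on_Rep2 f) \<and> Z = {\<rho> \<in> Rep2. \<forall>f\<in>\<F>. f \<rho> = 0})"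

definition zariski_dense :: "(f2 \<Rightarrow> psl3) set \<Rightarrow> bool" where
  "zariski_dense S \<longleftrightarrow> (\<forall>Z. zariski_closed Z \<and> S \<subseteq> Z \<longrightarrow> Z = Rep2)"

section \<open>The Kulkarni limit set\<close>

definition kul_L0 :: "psl3 set \<Rightarrow> cp2 set" where
  "kul_L0 G = closure {z. infinite {g \<in> G. act g z = z}}"

definition kul_L1 :: "psl3 set \<Rightarrow> cp2 set" where
  "kul_L1 G = closure {y. \<exists>z. z \<notin> kul_L0 G \<and> y islimpt ((\<lambda>g. act g z) ` G)}"

text \<open>
  As usual for Kulkarni's limit set, accumulation points of a family of sets are counted by
  the index: every neighborhood has to meet \<open>g(K)\<close> for infinitely many \<open>g\<close>.
\<close>

definition family_accumulation :: "psl3 set \<Rightarrow> cp2 set \<Rightarrow> cp2 set" where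
  "family_accumulation G K =
    {y. \<forall>V. open V \<and> y \<in> V \<longrightarrow> infinite {g \<in> G. act g ` K \<inter> V \<noteq> {}}}"

definition kul_L2 :: "psl3 set \<Rightarrow> cp2 set" where
  "kul_L2 G = closure
    (\<Union>K \<in> {K. compact K \<and> K \<inter> (kul_L0 G \<union> kul_L1 G) = {}}. family_accumulation G K)"

definition kul_limit :: "psl3 set \<Rightarrow> cp2 set" where
  "kul_limit G = kul_L0 G \<union> kul_L1 G \<union> kul_L2 G"

definition kul_domain :: "psl3 set \<Rightarrow> cp2 set" where
  "kul_domain G = - kul_limit G"

definition complex_kleinian :: "psl3 set \<Rightarrow> bool" where
  "complex_kleinian G \<longleftrightarrow> discrete_subgroup G \<and> kul_domain G \<noteq> {}"

definition K2 :: "(f2 \<Rightarrow> psl3) set" where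
  "K2 = {\<rho> \<in> Rep2. complex_kleinian (range \<rho>) \<and> \<not> virtually_cyclic (subgp PSL3 (range \<rho>))}"

definition dense_in_K2 :: "(f2 \<Rightarrow> psl3) set \<Rightarrow> bool" where
  "dense_in_K2 S \<longleftrightarrow> (\<forall>\<rho>\<in>K2. \<exists>\<sigma>. (\<forall>j::nat. \<sigma> j \<in> S) \<and> alg_converges \<sigma> \<rho>)"

definition general_position :: "cp2 set set \<Rightarrow> bool" where
  "general_position \<L> \<longleftrightarrow> (\<forall>L\<in>\<L>. proj_line L) \<and>
    (\<forall>L\<in>\<L>. \<forall>M\<in>\<L>. \<forall>N\<in>\<L>. L \<noteq> M \<and> M \<noteq> N \<and> L \<noteq> N \<longrightarrow> L \<inter> M \<inter> N = {})"

definition nu :: "psl3 set \<Rightarrow> enat" where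
  "nu G = (SUP \<L> \<in> {\<L>. general_position \<L> \<and> (\<forall>L\<in>\<L>. L \<subseteq> kul_limit G)}.
     if finite \<L> then enat (card \<L>) else \<infinity>)"

section \<open>The Schottky locus\<close>

definition strongly_irreducible :: "psl3 set \<Rightarrow> bool" where
  "strongly_irreducible G \<longleftrightarrow> (\<forall>H. finite_index (subgp PSL3 G) H \<longrightarrow>
    \<not> (\<exists>p. \<forall>g\<in>H. act g p = p) \<and> \<not> (\<exists>L. proj_line L \<and> (\<forall>g\<in>H. act g ` L = L)))"

text \<open>
  The non-increasing list of square roots of the eigenvalues, with multiplicity, of the
  product of the conjugate transpose with the matrix. It is the same for all lifts to
  SL(3,C) of an element of PSL(3,C), so \<open>log_sv\<close> may use the representative \<open>rep_psl3\<close>.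
\<close>

definition singular_values :: "complex^3^3 \<Rightarrow> real list" where
  "singular_values A = (THE l. length l = 3 \<and> sorted_wrt (\<ge>) l \<and> (\<forall>s\<in>set l. 0 \<le> s) \<and>
     (\<forall>z. det (mat z - (\<chi> i j. cnj (A $ j $ i)) ** A) =
          (\<Prod>s\<leftarrow>l. z - of_real (s\<^sup>2))))"

definition log_sv :: "nat \<Rightarrow> psl3 \<Rightarrow> real" where
  "log_sv i g = ln (singular_values (rep_psl3 g) ! (i - 1))"

definition theta_divergent :: "psl3 set \<Rightarrow> bool" where
  "theta_divergent G \<longleftrightarrow> (\<forall>g::nat \<Rightarrow> psl3. inj g \<and> range g \<subseteq> G \<longrightarrow>
     filterlim (\<lambda>n. log_sv 1 (g n) - log_sv 2 (g n)) at_top sequentially \<and>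
     filterlim (\<lambda>n. log_sv 2 (g n) - log_sv 3 (g n)) at_top sequentially)"

text \<open>An eigenvalue of algebraic multiplicity one and strictly largest modulus.\<close>

definition dominant_eigenvalue :: "complex^3^3 \<Rightarrow> complex \<Rightarrow> bool" where
  "dominant_eigenvalue A l \<longleftrightarrow> (\<exists>m n. cmod m < cmod l \<and> cmod n < cmod l \<and>
     (\<forall>z. det (mat z - A) = (z - l) * (z - m) * (z - n)))"

definition proximal :: "psl3 \<Rightarrow> bool" where
  "proximal g \<longleftrightarrow> (\<exists>l. dominant_eigenvalue (rep_psl3 g) l)"

definition attracting_point :: "psl3 \<Rightarrow> cp2 \<Rightarrow> bool" where
  "attracting_point g p \<longleftrightarrow> (\<exists>l v. dominant_eigenvalue (rep_psl3 g) l \<and> v \<noteq> 0 \<and>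
     rep_psl3 g *v v = l *s v \<and> p = abs_cp2 v)"

text \<open>
  Ping--pong of the four elements \<open>\<rho>(x_i)\<close>, \<open>\<rho>(x_i)\<inverse>\<close>: pairwise disjoint open neighborhoods
  of their attracting points such that the image of \<open>s\<close> maps every neighborhood, except the
  one belonging to the inverse of \<open>s\<close>, into the one belonging to \<open>s\<close>.
\<close>

definition ping_pong :: "(f2 \<Rightarrow> psl3) \<Rightarrow> bool" where
  "ping_pong \<rho> \<longleftrightarrow> (\<exists>D :: letter \<Rightarrow> cp2 set.
     (\<forall>s. open (D s) \<and> (\<exists>p\<in>D s. attracting_point (\<rho> (f2_letter s)) p)) \<and>
     (\<forall>s s'. s \<noteq> s' \<longrightarrow> D s \<inter> D s' = {}) \<and>
     (\<forall>s s'. s' \<noteq> inv_letter s \<longrightarrow> act (\<rho> (f2_letter s)) ` D s' \<subseteq> D s))"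

definition schottky_type :: "(f2 \<Rightarrow> psl3) \<Rightarrow> bool" where
  "schottky_type \<rho> \<longleftrightarrow> (\<forall>s. proximal (\<rho> (f2_letter s))) \<and> ping_pong \<rho>"

definition schottky_locus :: "(f2 \<Rightarrow> psl3) set \<Rightarrow> bool" where
  "schottky_locus S \<longleftrightarrow> S \<noteq> {} \<and> open_Rep2 S \<and>
     (\<forall>\<rho>\<in>S. inj \<rho> \<and> complex_kleinian (range \<rho>) \<and> strongly_irreducible (range \<rho>) \<and>
        theta_divergent (range \<rho>) \<and> schottky_type \<rho> \<and> nu (range \<rho>) = \<infinity>)"

section \<open>The diagonal elements\<close>

definition diag3 :: "complex \<Rightarrow> complex \<Rightarrow> complex \<Rightarrow> complex^3^3" where
  "diag3 p q r = (\<chi> i j. if i = j then vector [p, q, r] $ i else 0)"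

definition a_elt :: "real \<Rightarrow> psl3" where
  "a_elt t = abs_psl3 (diag3 (of_real (exp t)) (of_real (exp (- t))) 1)"

definition b_elt :: "real \<Rightarrow> psl3" where
  "b_elt t = abs_psl3 (diag3 1 (of_real (exp t)) (of_real (exp (- t))))"

end

theory Submission
  imports Defs
begin

text \<open>
  A representation close to \<open>\<rho>\<^sub>0\<close> sends both generators into the Zassenhaus neighborhood \<open>U\<close>.
  If its image is discrete, then the two images generate a subgroup of a nilpotent group, so a
  faithful representation would make the free group nilpotent. It is not, since it maps onto the
  infinite dihedral group.

  A regular function vanishing on a nonempty open set vanishes everywhere, because any two points
  of \<open>SL3\<close> lie on a rational curve in \<open>SL3\<close>.

  The image of \<open>\<rho>\<^sub>0\<close> is a discrete group of diagonal elements, free abelian of rank two. All points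
  on the three coordinate lines have infinite stabilizer, and on the complement of these lines the
  action is properly discontinuous, so \<open>[1 : 1 : 1]\<close> lies in the Kulkarni domain.
\<close>

section \<open>The group PSL(3,C) and its topology\<close>

lemma psl_rel_self [simp]: "psl_rel A A \<longleftrightarrow> A \<in> SL3"
  using psl_rel_refl psl_rel_def by blast

text \<open>The quotient is partial: the relation only concerns matrices in \<open>SL3\<close>, so a
  usable representative has to come with membership in \<open>SL3\<close>.\<close>

lemma psl3_cases [case_names abs, cases type: psl3]:
  obtains A where "A \<in> SL3" "g = abs_psl3 A"
  using psl3.abs_induct[of "\<lambda>g. \<exists>A. A \<in> SL3 \<and> g = abs_psl3 A" g] by auto

lemma mat_1_in_SL3 [simp]: "mat 1 \<in> SL3"
  by (simp add: SL3_def)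

lemma mult_in_SL3 [simp]: "A \<in> SL3 \<Longrightarrow> B \<in> SL3 \<Longrightarrow> A ** B \<in> SL3"
  by (simp add: SL3_def det_mul)

lemma psl3_mult_abs [simp]:
  "A \<in> SL3 \<Longrightarrow> B \<in> SL3 \<Longrightarrow> psl3_mult (abs_psl3 A) (abs_psl3 B) = abs_psl3 (A ** B)"
  by (simp add: psl3_mult.abs_eq)

lemma SL3_left_inverse:
  assumes "A \<in> SL3"
  obtains B where "B \<in> SL3" "B ** A = mat 1"
proof -
  have "invertible A" using assms by (simp add: SL3_def invertible_det_nz)
  then obtain B where B: "B ** A = mat 1" unfolding invertible_def by blast
  have "det B * det A = 1" using B by (metis det_mul det_I)
  then have "B \<in> SL3" using assms by (simp add: SL3_def)
  with B that show thesis by blast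
qed

lemma PSL3_simps [simp]:
  "carrier PSL3 = UNIV" "mult PSL3 = psl3_mult" "one PSL3 = psl3_one"
  by (simp_all add: PSL3_def)

lemma group_PSL3: "group PSL3"
proof (rule groupI)
  fix x y z assume "x \<in> carrier PSL3" "y \<in> carrier PSL3" "z \<in> carrier PSL3"
  obtain A B C where "A \<in> SL3" "x = abs_psl3 A" "B \<in> SL3" "y = abs_psl3 B" "C \<in> SL3" "z = abs_psl3 C"
    by (metis psl3_cases)
  then show "x \<otimes>\<^bsub>PSL3\<^esub> y \<otimes>\<^bsub>PSL3\<^esub> z = x \<otimes>\<^bsub>PSL3\<^esub> (y \<otimes>\<^bsub>PSL3\<^esub> z)"
    by (simp add: matrix_mul_assoc)
next
  fix x
  obtain A where A: "A \<in> SL3" "x = abs_psl3 A" by (metis psl3_cases)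
  then show "\<one>\<^bsub>PSL3\<^esub> \<otimes>\<^bsub>PSL3\<^esub> x = x" by (simp add: psl3_one.abs_eq)
  obtain B where B: "B \<in> SL3" "B ** A = mat 1" using SL3_left_inverse A(1) .
  show "\<exists>y\<in>carrier PSL3. y \<otimes>\<^bsub>PSL3\<^esub> x = \<one>\<^bsub>PSL3\<^esub>"
    by (rule bexI[of _ "abs_psl3 B"]) (use A B in \<open>simp_all add: psl3_one.abs_eq\<close>)
qed auto

interpretation PSL3: group PSL3
  by (rule group_PSL3)

lemma det_mat_3: "det (mat c :: complex^3^3) = c ^ 3"
  by (simp add: det_3 mat_def power3_eq_cube)

text \<open>Comparing determinants gives \<open>c ^ 3 = 1\<close>, so two lifts of one element
  differ by a scalar of modulus one.\<close>

lemma psl_rel_norm_1: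
  assumes "psl_rel A B"
  obtains c where "cmod c = 1" "B = mat c ** A"
proof -
  obtain c where c: "A \<in> SL3" "B \<in> SL3" "B = mat c ** A"
    using assms unfolding psl_rel_iff by blast
  have "det B = c ^ 3 * det A"
    unfolding c(3) det_mul det_mat_3 ..
  then have "c ^ 3 = 1" using c(1,2) by (simp add: SL3_def)

  then have "cmod c = 1" using power_eq_1_iff[of c 3] by simp
  with c that show thesis by blast
qed

text \<open>Entries are determined only up to a common cube root of unity. Their moduli descend to
  the quotient and serve as continuous functions separating the diagonal elements.\<close>

lift_definition entry_norm :: "psl3 \<Rightarrow> 3 \<Rightarrow> 3 \<Rightarrow> real" is "\<lambda>A i j. cmod (A $ i $ j)"
proof (intro ext)
  fix A B :: "complex^3^3" and i j assume "psl_rel A B"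
  then obtain c where "cmod c = 1" "B = mat c ** A" by (rule psl_rel_norm_1)
  then show "cmod (A $ i $ j) = cmod (B $ i $ j)"
    by (simp add: norm_mult flip: scalar_matrix_mult)
qed

lemma entry_norm_abs [simp]: "A \<in> SL3 \<Longrightarrow> entry_norm (abs_psl3 A) i j = cmod (A $ i $ j)"
  by (simp add: entry_norm.abs_eq)

lemma continuous_on_entry_norm: "continuous_on UNIV (\<lambda>g. entry_norm g i j)"
  unfolding continuous_on_open_vimage[OF open_UNIV]
proof (intro allI impI)
  fix S :: "real set" assume "open S"
  have "{A \<in> SL3. abs_psl3 A \<in> (\<lambda>g. entry_norm g i j) -` S} = SL3 \<inter> (\<lambda>A. cmod (A $ i $ j)) -` S"
    by auto
  moreover have "open ((\<lambda>A::complex^3^3. cmod (A $ i $ j)) -` S)"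
    by (rule open_vimage[OF \<open>open S\<close>]) (intro continuous_intros)
  ultimately have "open ((\<lambda>g. entry_norm g i j) -` S)"
    by (simp add: open_psl3_def openin_open_Int)
  then show "open ((\<lambda>g. entry_norm g i j) -` S \<inter> UNIV)" by simp
qed

text \<open>Open sets of the quotient pull back to relatively open subsets of \<open>SL3\<close>;
  this is why \<open>f\<close> must eventually stay in \<open>SL3\<close>.\<close>

lemma tendsto_abs_psl3:
  assumes "(f \<longlongrightarrow> A) F" "A \<in> SL3" "eventually (\<lambda>x. f x \<in> SL3) F"
  shows "((\<lambda>x. abs_psl3 (f x)) \<longlongrightarrow> abs_psl3 A) F"
proof (rule topological_tendstoI)
  fix V assume V: "open V" "abs_psl3 A \<in> V"
  then obtain T where T: "open T" "{B \<in> SL3. abs_psl3 B \<in> V} = SL3 \<inter> T"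
    unfolding open_psl3_def openin_open by blast
  have "A \<in> T" using T V assms(2) by blast
  then have "eventually (\<lambda>x. f x \<in> T) F" using topological_tendstoD[OF assms(1) T(1)] by simp
  with assms(3) show "eventually (\<lambda>x. abs_psl3 (f x) \<in> V) F"
    by eventually_elim (use T in auto)
qed

section \<open>Non-nilpotency of the free group\<close>

lemma F2_simps [simp]: "carrier F2 = UNIV" "mult F2 = f2_mult" "one F2 = f2_one"
  by (simp_all add: F2_def)

lemma monoid_F2: "monoid F2"
  by unfold_locales (simp_all; transfer; simp)+

lemma f2_letter_inverse: "f2_mult (f2_letter s) (f2_letter (inv_letter s)) = f2_one"
  unfolding f2_letter_def
proof transfer
  fix s
  show "equivclp cancels ([s] @ [inv_letter s]) []"
    using cancels.intros[of "[]" s "[]"] by (simp add: r_into_equivclp)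
qed

lemma f2_induct [case_names one letter, induct type: f2]:
  assumes "P f2_one" and "\<And>s \<gamma>. P \<gamma> \<Longrightarrow> P (f2_mult (f2_letter s) \<gamma>)"
  shows "P \<gamma>"
proof -
  have "P (abs_f2 w)" for w
  proof (induction w)
    case Nil
    show ?case using assms(1) by (simp add: f2_one.abs_eq)
  next
    case (Cons s w)
    have "abs_f2 (s # w) = f2_mult (f2_letter s) (abs_f2 w)"
      by (simp add: f2_letter_def f2_mult.abs_eq)
    with Cons assms(2) show ?case by simp
  qed
  then show ?thesis by (metis f2.abs_induct)
qed

lemma inv_inv_letter [simp]: "inv_letter (inv_letter s) = s"
  by (cases s) simp

text \<open>The units of a monoid are closed under products, and each letter is a unit because the
  inverse letter cancels it on both sides. No inversion of words has to be defined.\<close>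

lemma group_F2: "group F2"
proof -
  interpret monoid F2 by (rule monoid_F2)
  have "\<gamma> \<in> Units F2" for \<gamma>
  proof (induction \<gamma>)
    case one
    show ?case using Units_one_closed by simp
  next
    case (letter s \<gamma>)
    have "f2_letter s \<in> Units F2"
      using f2_letter_inverse[of s] f2_letter_inverse[of "inv_letter s"]
      by (auto simp: Units_def)
    with letter show ?case using Units_m_closed by fastforce
  qed
  then show ?thesis by unfold_locales auto
qed

interpretation F2: group F2
  by (rule group_F2)

text \<open>A homomorphism onto the infinite dihedral group of isometries of the integers:
  \<open>x1\<close> acts as a reflection and \<open>x2\<close> as a translation.\<close>

fun dihedral_letter :: "letter \<Rightarrow> int \<Rightarrow> int" where
  "dihedral_letter (X1, e) = uminus"
| "dihedral_letter (X2, e) = (\<lambda>k. if e then k + 1 else k - 1)"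

text \<open>A word acts by composing the maps of its letters, last letter first. The action depends
  only on the class because a cancelling pair composes to the identity.\<close>

lift_definition dihedral :: "f2 \<Rightarrow> int \<Rightarrow> int" is "\<lambda>w. foldr dihedral_letter w"
proof -
  fix u v assume "equivclp cancels u v"
  then show "foldr dihedral_letter u = foldr dihedral_letter v"
  proof (induction rule: equivclp_induct)
    case (step y z)
    have "foldr dihedral_letter u = foldr dihedral_letter v" if "cancels u v" for u v
      using that
    proof (cases rule: cancels.cases)
      case (1 a s b)
      \<comment> \<open>A reflection is an involution, so both signs of \<open>X1\<close> may act by
        the same map.\<close>
      have "dihedral_letter s \<circ> dihedral_letter (inv_letter s) = id"
        by (cases s; cases "fst s") (auto simp: fun_eq_iff)
      then show ?thesis using 1 by (simp add: fun_eq_iff)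
    qed
    with step show ?case by metis
  qed simp
qed

lemma dihedral_mult [simp]: "dihedral (f2_mult a b) k = dihedral a (dihedral b k)"
  by transfer simp

lemma dihedral_one [simp]: "dihedral f2_one k = k"
  by transfer simp

lemma dihedral_letter_eq [simp]: "dihedral (f2_letter s) = dihedral_letter s"
  unfolding f2_letter_def by transfer simp

lemma dihedral_inv: "dihedral (inv\<^bsub>F2\<^esub> a) (dihedral a k) = k"
  using F2.l_inv[of a] dihedral_mult[of "inv\<^bsub>F2\<^esub> a" a k] by simp

text \<open>Nested commutators \<open>[...[[x2, x1], x1]..., x1]\<close>, with factors in the order
  used by \<open>lower_central\<close>, so that the \<open>n\<close>-th one lies in the
  \<open>n\<close>-th term of that series.\<close>

primrec iter_comm :: "nat \<Rightarrow> f2" where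
  "iter_comm 0 = x2"
| "iter_comm (Suc n) = iter_comm n \<otimes>\<^bsub>F2\<^esub> x1 \<otimes>\<^bsub>F2\<^esub> inv\<^bsub>F2\<^esub> iter_comm n \<otimes>\<^bsub>F2\<^esub> inv\<^bsub>F2\<^esub> x1"

text \<open>The commutator of a translation with a reflection is the translation by twice the amount.\<close>

lemma dihedral_iter_comm: "dihedral (iter_comm n) k = k + 2 ^ n"
proof (induction n arbitrary: k)
  case (Suc n)
  have x1: "dihedral (inv\<^bsub>F2\<^esub> x1) k = - k" for k
    using dihedral_inv[of x1 "- k"] by simp
  have "dihedral (inv\<^bsub>F2\<^esub> iter_comm n) k = k - 2 ^ n" for k
    using dihedral_inv[of "iter_comm n" "k - 2 ^ n"] by (simp add: Suc)
  then show ?case by (simp add: Suc x1)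
qed simp

lemma iter_comm_neq_one: "iter_comm n \<noteq> f2_one"
proof
  assume "iter_comm n = f2_one"
  then have "dihedral (iter_comm n) 0 = 0" by simp
  then show False by (simp add: dihedral_iter_comm)
qed

section \<open>Faithful representations and Zassenhaus neighborhoods\<close>

text \<open>The image of the \<open>n\<close>-th nested commutator lies in the \<open>n\<close>-th
  lower central term of \<open>H\<close>. It is never trivial, by injectivity, so the series cannot
  reach the trivial group.\<close>

lemma hom_not_nilpotent:
  assumes "\<rho> \<in> hom F2 G" "inj \<rho>" "group G" "subgroup H G" "\<rho> x1 \<in> H" "\<rho> x2 \<in> H"
  shows "\<not> nilpotent_group (subgp G H)"
proof
  assume "nilpotent_group (subgp G H)"
  interpret G: group G by fact
  interpret \<rho>: group_hom F2 G \<rho>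
    using assms(1) by unfold_locales
  interpret H: subgroup H G by fact
  have inv_H: "inv\<^bsub>subgp G H\<^esub> x = inv\<^bsub>G\<^esub> x" if "x \<in> H" for x
    using that assms(4) by (simp add: subgp_def)
  \<comment> \<open>Membership in \<open>H\<close> is carried through the induction because inverses
    in \<open>H\<close> and in \<open>G\<close> are identified only for elements of
    \<open>H\<close>.\<close>
  have iter: "\<rho> (iter_comm n) \<in> H \<and> \<rho> (iter_comm n) \<in> lower_central (subgp G H) n" for n
  proof (induction n)
    case 0
    then show ?case using assms(6) by (simp add: subgp_def)
  next
    case (Suc n)
    let ?c = "\<rho> (iter_comm n)"
    have eq: "\<rho> (iter_comm (Suc n)) = ?c \<otimes>\<^bsub>G\<^esub> \<rho> x1 \<otimes>\<^bsub>G\<^esub> inv\<^bsub>G\<^esub> ?c \<otimes>\<^bsub>G\<^esub> inv\<^bsub>G\<^esub> \<rho> x1"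
      using \<rho>.hom_mult \<rho>.hom_inv by simp
    have "\<rho> (iter_comm (Suc n)) = ?c \<otimes>\<^bsub>subgp G H\<^esub> \<rho> x1 \<otimes>\<^bsub>subgp G H\<^esub>
        inv\<^bsub>subgp G H\<^esub> ?c \<otimes>\<^bsub>subgp G H\<^esub> inv\<^bsub>subgp G H\<^esub> \<rho> x1"
      unfolding eq using inv_H Suc assms(5) by (simp add: subgp_def)
    moreover have "\<rho> x1 \<in> carrier (subgp G H)" using assms(5) by (simp add: subgp_def)
    ultimately have "\<rho> (iter_comm (Suc n)) \<in> lower_central (subgp G H) (Suc n)"
      using Suc unfolding lower_central.simps by (intro generate.incl) blast
    moreover have "\<rho> (iter_comm (Suc n)) \<in> H"
      unfolding eq using Suc assms(5) by simp
    ultimately show ?case by blast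
  qed
  from \<open>nilpotent_group (subgp G H)\<close> obtain n where "lower_central (subgp G H) n = {\<one>\<^bsub>subgp G H\<^esub>}"
    unfolding nilpotent_group_def by blast
  then have "\<rho> (iter_comm n) = \<one>\<^bsub>G\<^esub>" using iter[of n] by (simp add: subgp_def)
  also have "\<dots> = \<rho> f2_one" using \<rho>.hom_one by simp
  finally show False using iter_comm_neq_one assms(2) by (metis injD)
qed

text \<open>As \<open>U\<close> is open, convergence at the two generators puts both images into
  \<open>U\<close> for one common \<open>j\<close>. They then lie in the group generated by the
  discrete image intersected with \<open>U\<close>, which is nilpotent.\<close>

lemma zassenhaus_not_converges:
  assumes "zassenhaus_nbhd U" "\<sigma> x1 \<in> U" "\<sigma> x2 \<in> U"
    and "\<And>j. \<rho> j \<in> Rep2" "\<And>j. inj (\<rho> j)" "\<And>j. discrete_subgroup (range (\<rho> j))"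
  shows "\<not> alg_converges \<rho> \<sigma>"
proof
  assume "alg_converges \<rho> \<sigma>"
  then have lim: "(\<lambda>j. \<rho> j \<gamma>) \<longlonglongrightarrow> \<sigma> \<gamma>" for \<gamma>
    unfolding alg_converges_def by blast
  have "open U" using assms(1) unfolding zassenhaus_nbhd_def by blast
  then have "eventually (\<lambda>j. \<rho> j x1 \<in> U \<and> \<rho> j x2 \<in> U) sequentially"
    using assms(2,3) by (intro eventually_conj topological_tendstoD[OF lim])
  then obtain j where j: "\<rho> j x1 \<in> U" "\<rho> j x2 \<in> U"
    unfolding eventually_sequentially by blast
  let ?H = "generate PSL3 (range (\<rho> j) \<inter> U)"
  have "subgroup ?H PSL3" by (rule PSL3.generate_is_subgroup) simp
  moreover have "\<rho> j x1 \<in> ?H" "\<rho> j x2 \<in> ?H" using j by (auto intro: generate.incl)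
  ultimately have "\<not> nilpotent_group (subgp PSL3 ?H)"
    using hom_not_nilpotent[of "\<rho> j" PSL3 ?H] assms(4,5) group_PSL3 by (simp add: Rep2_def)
  moreover have "nilpotent_group (subgp PSL3 ?H)"
    using assms(1,6) unfolding zassenhaus_nbhd_def by blast
  ultimately show False by blast
qed

section \<open>Zariski density\<close>

text \<open>Dividing the first column of the affine path \<open>(1 - z) A + z B\<close> by its determinant
  gives a path in \<open>SL3\<close> whose entries are rational in \<open>z\<close>.\<close>

lemma SL3_rational_path:
  assumes "A \<in> SL3" "B \<in> SL3"
  obtains d :: "complex poly" and N where
    "poly d 0 \<noteq> 0" "poly d 1 \<noteq> 0" "N 0 = A" "N 1 = B" "\<And>z. poly d z \<noteq> 0 \<Longrightarrow> N z \<in> SL3"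
    "\<And>i j. \<exists>P. \<forall>z. poly d z \<noteq> 0 \<longrightarrow> poly d z * N z $ i $ j = poly P z"
proof -
  define m where "m i j = [:A $ i $ j, B $ i $ j - A $ i $ j:]" for i j
  define M :: "complex \<Rightarrow> complex^3^3" where "M z = (\<chi> i j. poly (m i j) z)" for z
  \<comment> \<open>The determinant of \<open>M z\<close>, expanded as a polynomial in
    \<open>z\<close>.\<close>
  define d where "d = m 1 1 * m 2 2 * m 3 3 + m 1 2 * m 2 3 * m 3 1 + m 1 3 * m 2 1 * m 3 2
    - m 1 1 * m 2 3 * m 3 2 - m 1 2 * m 2 1 * m 3 3 - m 1 3 * m 2 2 * m 3 1"
  \<comment> \<open>Scaling a single column divides the determinant exactly once, which avoids
    extracting a cube root.\<close>
  define N :: "complex \<Rightarrow> complex^3^3" where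
    "N z = (\<chi> i j. if j = 1 then M z $ i $ j / poly d z else M z $ i $ j)" for z
  have d: "poly d z = det (M z)" for z
    by (simp add: d_def M_def det_3)
  have "M 0 = A" "M 1 = B"
    by (simp_all add: M_def m_def vec_eq_iff)
  then have d01: "poly d 0 = 1" "poly d 1 = 1"
    using assms by (simp_all add: d SL3_def)
  show thesis
  proof (rule that)
    show "N 0 = A" "N 1 = B"
      using \<open>M 0 = A\<close> \<open>M 1 = B\<close> by (simp_all add: N_def d01 vec_eq_iff)
    show "N z \<in> SL3" if "poly d z \<noteq> 0" for z
    proof -
      have "poly d z * det (N z) = det (M z)"
        using that by (simp add: N_def det_3 field_simps)
      then show ?thesis using that by (simp add: SL3_def d)
    qed
    fix i j
    \<comment> \<open>Multiplication by \<open>d\<close> clears the denominator of the first column;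
      the other entries are already polynomial.\<close>
    show "\<exists>P. \<forall>z. poly d z \<noteq> 0 \<longrightarrow> poly d z * N z $ i $ j = poly P z"
      by (rule exI[of _ "if j = 1 then m i j else d * m i j"]) (simp add: N_def M_def)
  qed (simp_all add: d01)
qed

text \<open>Both paths share the denominator \<open>d\<close>, and \<open>k\<close> counts how many
  factors of it accumulate while the polynomial is built up.\<close>

lemma poly_fun_rational_path:
  fixes d :: "complex poly"
  assumes "poly_fun p"
    and M: "\<And>i j. \<exists>P. \<forall>z. poly d z \<noteq> 0 \<longrightarrow> poly d z * M z $ i $ j = poly P z"
    and N: "\<And>i j. \<exists>P. \<forall>z. poly d z \<noteq> 0 \<longrightarrow> poly d z * N z $ i $ j = poly P z"
  shows "\<exists>k P. \<forall>z. poly d z \<noteq> 0 \<longrightarrow> poly d z ^ k * p (M z) (N z) = poly P z"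
  using assms(1)
proof (induction rule: poly_fun.induct)
  case (1 c)
  show ?case by (rule exI[of _ 0], rule exI[of _ "[:c:]"]) simp
next
  case (2 i j)
  show ?case by (rule exI[of _ 1]) (use M[of i j] in simp)
next
  case (3 i j)
  show ?case by (rule exI[of _ 1]) (use N[of i j] in simp)
next
  case (4 p q)
  then obtain k P l Q where
    "\<forall>z. poly d z \<noteq> 0 \<longrightarrow> poly d z ^ k * p (M z) (N z) = poly P z"
    "\<forall>z. poly d z \<noteq> 0 \<longrightarrow> poly d z ^ l * q (M z) (N z) = poly Q z" by blast
  then have "\<forall>z. poly d z \<noteq> 0 \<longrightarrow>
      poly d z ^ (k + l) * (p (M z) (N z) + q (M z) (N z)) = poly (d ^ l * P + d ^ k * Q) z"
    by (auto simp: power_add algebra_simps poly_power dest!: spec)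
  then show ?case by blast
next
  case (5 p q)
  then obtain k P l Q where
    "\<forall>z. poly d z \<noteq> 0 \<longrightarrow> poly d z ^ k * p (M z) (N z) = poly P z"
    "\<forall>z. poly d z \<noteq> 0 \<longrightarrow> poly d z ^ l * q (M z) (N z) = poly Q z" by blast
  then have "\<forall>z. poly d z \<noteq> 0 \<longrightarrow>
      poly d z ^ (k + l) * (p (M z) (N z) * q (M z) (N z)) = poly (P * Q) z"
    by (auto simp: power_add algebra_simps dest!: spec)
  then show ?case by blast
qed

text \<open>Near \<open>w\<close> the denominator does not vanish, so each entry agrees there with a
  continuous quotient of polynomials.\<close>

lemma tendsto_rational_path:
  fixes d :: "complex poly" and N :: "complex \<Rightarrow> complex^3^3"
  assumes "\<And>i j. \<exists>P. \<forall>z. poly d z \<noteq> 0 \<longrightarrow> poly d z * N z $ i $ j = poly P z" "poly d w \<noteq> 0"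
  shows "(N \<longlongrightarrow> N w) (nhds w)"
proof (intro vec_tendstoI)
  fix i j
  obtain P where P: "\<And>z. poly d z \<noteq> 0 \<Longrightarrow> poly d z * N z $ i $ j = poly P z"
    using assms(1) by blast
  have eq: "poly P z / poly d z = N z $ i $ j" if "poly d z \<noteq> 0" for z
    using P[OF that] that by (simp add: field_simps)
  have "isCont (\<lambda>z. poly P z / poly d z) w"
    using assms(2) by (intro continuous_intros) auto
  then have "((\<lambda>z. poly P z / poly d z) \<longlongrightarrow> N w $ i $ j) (nhds w)"
    using tendsto_at_iff_tendsto_nhds[of "\<lambda>z. poly P z / poly d z" w]
    by (simp add: eq assms(2) isCont_def)
  moreover have "eventually (\<lambda>z. poly d z \<noteq> 0) (nhds w)"
  proof -
    have "open {z. poly d z \<noteq> 0}"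
      by (intro open_Collect_neq continuous_intros)
    then show ?thesis using eventually_nhds_in_open[of "{z. poly d z \<noteq> 0}" w] assms(2) by simp
  qed
  then have "eventually (\<lambda>z. poly P z / poly d z = N z $ i $ j) (nhds w)"
    by eventually_elim (rule eq)
  ultimately show "((\<lambda>z. N z $ i $ j) \<longlongrightarrow> N w $ i $ j) (nhds w)"
    by (rule Lim_transform_eventually)
qed

text \<open>Rational paths join the base point over \<open>W\<close> to the given pair. Along them
  \<open>p\<close>, cleared of denominators, is a polynomial in one variable that vanishes near
  \<open>0\<close>, hence identically; at \<open>1\<close> it gives the claim.\<close>

lemma poly_fun_eq_0:
  assumes p: "poly_fun p" and W: "open W" "(abs_psl3 A\<^sub>0, abs_psl3 B\<^sub>0) \<in> W" "A\<^sub>0 \<in> SL3" "B\<^sub>0 \<in> SL3"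
    and zero: "\<And>A B. A \<in> SL3 \<Longrightarrow> B \<in> SL3 \<Longrightarrow> (abs_psl3 A, abs_psl3 B) \<in> W \<Longrightarrow> p A B = 0"
    and "A \<in> SL3" "B \<in> SL3"
  shows "p A B = 0"
proof -
  obtain d M where M: "poly d 0 \<noteq> 0" "poly d 1 \<noteq> 0" "M 0 = A\<^sub>0" "M 1 = A"
      "\<And>z. poly d z \<noteq> 0 \<Longrightarrow> M z \<in> SL3"
      "\<And>i j. \<exists>P. \<forall>z. poly d z \<noteq> 0 \<longrightarrow> poly d z * M z $ i $ j = poly P z"
    using SL3_rational_path[OF \<open>A\<^sub>0 \<in> SL3\<close> \<open>A \<in> SL3\<close>] by blast
  obtain e N where N: "poly e 0 \<noteq> 0" "poly e 1 \<noteq> 0" "N 0 = B\<^sub>0" "N 1 = B"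
      "\<And>z. poly e z \<noteq> 0 \<Longrightarrow> N z \<in> SL3"
      "\<And>i j. \<exists>P. \<forall>z. poly e z \<noteq> 0 \<longrightarrow> poly e z * N z $ i $ j = poly P z"
    using SL3_rational_path[OF \<open>B\<^sub>0 \<in> SL3\<close> \<open>B \<in> SL3\<close>] by blast
  \<comment> \<open>The product \<open>d * e\<close> is a common denominator for the two
    paths.\<close>
  have "\<exists>P. \<forall>z. poly (d * e) z \<noteq> 0 \<longrightarrow> poly (d * e) z * M z $ i $ j = poly P z" for i j
  proof -
    obtain P where "\<forall>z. poly d z \<noteq> 0 \<longrightarrow> poly d z * M z $ i $ j = poly P z" using M(6) by blast
    then show ?thesis by (intro exI[of _ "e * P"]) auto
  qed
  moreover have "\<exists>P. \<forall>z. poly (d * e) z \<noteq> 0 \<longrightarrow> poly (d * e) z * N z $ i $ j = poly P z" for i j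
  proof -
    obtain P where "\<forall>z. poly e z \<noteq> 0 \<longrightarrow> poly e z * N z $ i $ j = poly P z" using N(6) by blast
    then show ?thesis by (intro exI[of _ "d * P"]) auto
  qed
  ultimately obtain k P where
    P: "\<And>z. poly (d * e) z \<noteq> 0 \<Longrightarrow> poly (d * e) z ^ k * p (M z) (N z) = poly P z"
    using poly_fun_rational_path[OF p, of "d * e" M N] by blast
  have lim: "(M \<longlongrightarrow> A\<^sub>0) (nhds 0)" "(N \<longlongrightarrow> B\<^sub>0) (nhds 0)"
    using tendsto_rational_path[of d M 0] tendsto_rational_path[of e N 0] M N by auto
  have "open {z. poly (d * e) z \<noteq> 0}"
    by (intro open_Collect_neq continuous_intros)
  then have ev: "eventually (\<lambda>z. poly (d * e) z \<noteq> 0) (nhds 0)"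
    using eventually_nhds_in_open[of "{z. poly (d * e) z \<noteq> 0}" 0] M(1) N(1) by simp
  have "((\<lambda>z. (abs_psl3 (M z), abs_psl3 (N z))) \<longlongrightarrow> (abs_psl3 A\<^sub>0, abs_psl3 B\<^sub>0)) (nhds 0)"
    using ev M(5) N(5) \<open>A\<^sub>0 \<in> SL3\<close> \<open>B\<^sub>0 \<in> SL3\<close>
    by (intro tendsto_Pair tendsto_abs_psl3 lim) (auto elim!: eventually_mono)
  then have "eventually (\<lambda>z. (abs_psl3 (M z), abs_psl3 (N z)) \<in> W) (nhds 0)"
    using topological_tendstoD W(1,2) by blast
  with ev have "eventually (\<lambda>z. poly P z = 0) (nhds 0)"
  proof eventually_elim
    case (elim z)
    then have "p (M z) (N z) = 0" using zero M(5) N(5) by simp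
    then show ?case using P[OF elim(1)] by simp
  qed
  then obtain S where S: "open S" "0 \<in> S" "S \<subseteq> {z. poly P z = 0}"
    unfolding eventually_nhds by blast
  \<comment> \<open>A nonempty open subset of the complex plane is infinite, while a nonzero
    polynomial has finitely many roots.\<close>
  have "infinite S" using S finite_imp_not_open by blast
  then have "P = 0" using S(3) poly_roots_finite[of P] finite_subset by blast
  then show ?thesis using P[of 1] M(2,4) N(2,4) by simp
qed

lemma zariski_dense_open:
  assumes "open_Rep2 S" "S \<noteq> {}"
  shows "zariski_dense S"
  unfolding zariski_dense_def
proof (intro allI impI; elim conjE)
  fix Z assume "zariski_closed Z" "S \<subseteq> Z"
  then obtain \<F> where \<F>: "\<forall>f\<in>\<F>. regular_on_Rep2 f" "Z = {\<rho> \<in> Rep2. \<forall>f\<in>\<F>. f \<rho> = 0}"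
    unfolding zariski_closed_def by blast
  let ?W = "(\<lambda>\<rho>. (\<rho> x1, \<rho> x2)) ` S"
  have S: "S \<subseteq> Rep2" "open ?W" using assms(1) unfolding open_Rep2_def by auto
  obtain \<sigma> where "\<sigma> \<in> S" using assms(2) by blast
  obtain A\<^sub>0 where A0: "A\<^sub>0 \<in> SL3" "\<sigma> x1 = abs_psl3 A\<^sub>0" by (metis psl3_cases)
  obtain B\<^sub>0 where B0: "B\<^sub>0 \<in> SL3" "\<sigma> x2 = abs_psl3 B\<^sub>0" by (metis psl3_cases)
  have in_W: "(abs_psl3 A\<^sub>0, abs_psl3 B\<^sub>0) \<in> ?W" using A0 B0 \<open>\<sigma> \<in> S\<close> by (intro image_eqI[of _ _ \<sigma>]) simp_all
  have "f \<rho> = 0" if "f \<in> \<F>" "\<rho> \<in> Rep2" for f \<rho>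
  proof -
    obtain p where p: "poly_fun p"
      "\<And>\<rho> A B. \<lbrakk>\<rho> \<in> Rep2; A \<in> SL3; B \<in> SL3; \<rho> x1 = abs_psl3 A; \<rho> x2 = abs_psl3 B\<rbrakk>
        \<Longrightarrow> f \<rho> = p A B"
      using \<F>(1) \<open>f \<in> \<F>\<close> unfolding regular_on_Rep2_def by blast
    obtain A where A: "A \<in> SL3" "\<rho> x1 = abs_psl3 A" by (metis psl3_cases)
    obtain B where B: "B \<in> SL3" "\<rho> x2 = abs_psl3 B" by (metis psl3_cases)
    have "p A B = 0"
    proof (rule poly_fun_eq_0[OF p(1) S(2) in_W A0(1) B0(1) _ A(1) B(1)])
      \<comment> \<open>Every pair in \<open>?W\<close> comes from a representation in
        \<open>S\<close>, and there \<open>f\<close> vanishes and equals \<open>p\<close> at any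
        choice of lifts.\<close>
      fix C D assume CD: "C \<in> SL3" "D \<in> SL3" "(abs_psl3 C, abs_psl3 D) \<in> ?W"
      then obtain \<tau> where \<tau>: "\<tau> \<in> S" "\<tau> x1 = abs_psl3 C" "\<tau> x2 = abs_psl3 D" by auto
      then have "f \<tau> = p C D" using p(2) S(1) CD by blast
      moreover have "f \<tau> = 0" using \<tau>(1) \<open>S \<subseteq> Z\<close> \<open>f \<in> \<F>\<close> unfolding \<F>(2) by blast
      ultimately show "p C D = 0" by simp
    qed
    then show ?thesis using p(2) that A B by metis
  qed
  then show "Z = Rep2" unfolding \<F>(2) by blast
qed

section \<open>The diagonal group\<close>

lemma diag3_nth [simp]:
  "diag3 p q r $ 1 $ 1 = p" "diag3 p q r $ 2 $ 2 = q" "diag3 p q r $ 3 $ 3 = r"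
  by (simp_all add: diag3_def)

lemma diag3_in_SL3: "diag3 p q r \<in> SL3 \<longleftrightarrow> p * q * r = 1"
  by (simp add: SL3_def det_3 diag3_def)

lemma diag3_mult: "diag3 p q r ** diag3 p' q' r' = diag3 (p * p') (q * q') (r * r')"
  by (simp add: vec_eq_iff matrix_matrix_mult_def diag3_def forall_3 sum_3)

lemma diag3_mult_vec: "diag3 p q r *v v = vector [p * v $ 1, q * v $ 2, r * v $ 3]"
  by (simp add: vec_eq_iff matrix_vector_mult_def diag3_def forall_3 sum_3)

text \<open>The element \<open>a^m b^n\<close> for \<open>a = a_elt t\<close> and
  \<open>b = b_elt t\<close>; the three exponents sum to zero.\<close>

definition diag_elt :: "real \<Rightarrow> int \<Rightarrow> int \<Rightarrow> psl3" where
  "diag_elt t m n = abs_psl3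
    (diag3 (of_real (exp (t * m))) (of_real (exp (t * (n - m)))) (of_real (exp (- t * n))))"

lemma diag_elt_in_SL3 [simp]:
  "diag3 (of_real (exp (t * real_of_int m))) (of_real (exp (t * (real_of_int n - real_of_int m))))
    (of_real (exp (- (t * real_of_int n)))) \<in> SL3"
proof -
  have "exp (t * real_of_int m) * exp (t * (real_of_int n - real_of_int m)) * exp (- (t * real_of_int n)) = 1"
    by (simp add: mult_exp_exp algebra_simps)
  then show ?thesis by (simp add: diag3_in_SL3 flip: of_real_mult)
qed

lemma a_elt_eq: "a_elt t = diag_elt t 1 0"
  by (simp add: a_elt_def diag_elt_def)

lemma b_elt_eq: "b_elt t = diag_elt t 0 1"
  by (simp add: b_elt_def diag_elt_def)

lemma diag_elt_0: "diag_elt t 0 0 = psl3_one"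
  unfolding diag_elt_def psl3_one.abs_eq
  by (rule arg_cong[of _ _ abs_psl3]) (simp add: diag3_def mat_def vec_eq_iff forall_3)

lemma diag_elt_mult: "psl3_mult (diag_elt t m n) (diag_elt t p q) = diag_elt t (m + p) (n + q)"
  unfolding diag_elt_def
  by (subst psl3_mult_abs; (simp del: of_real_mult)?)
    (simp add: diag3_mult algebra_simps flip: of_real_mult exp_add)

lemma diag_elt_inv: "inv\<^bsub>PSL3\<^esub> (diag_elt t m n) = diag_elt t (- m) (- n)"
  by (rule PSL3.inv_equality) (simp_all add: diag_elt_mult diag_elt_0)

lemma diag_elt_nat_pow: "diag_elt t m n [^]\<^bsub>PSL3\<^esub> (k :: nat) = diag_elt t (k * m) (k * n)"
  by (induction k) (simp_all add: diag_elt_mult diag_elt_0 algebra_simps)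

lemma diag_elt_int_pow: "diag_elt t m n [^]\<^bsub>PSL3\<^esub> (k :: int) = diag_elt t (k * m) (k * n)"
  by (cases k rule: int_cases2)
    (simp_all add: int_pow_int PSL3.int_pow_neg_int diag_elt_nat_pow diag_elt_inv)

lemma entry_norm_diag_elt:
  "entry_norm (diag_elt t m n) 1 1 = exp (t * m)" "entry_norm (diag_elt t m n) 3 3 = exp (- (t * n))"
  by (simp_all add: diag_elt_def)

text \<open>The moduli of the first and third diagonal entries recover \<open>m\<close> and
  \<open>n\<close>.\<close>

lemma diag_elt_eq_iff:
  assumes "t > 0" shows "diag_elt t m n = diag_elt t p q \<longleftrightarrow> m = p \<and> n = q"
proof
  assume "diag_elt t m n = diag_elt t p q"
  then have "exp (t * m) = exp (t * p)" "exp (- (t * n)) = exp (- (t * q))"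
    by (metis entry_norm_diag_elt)+
  then show "m = p \<and> n = q" using assms by simp
qed simp

definition diag_group :: "real \<Rightarrow> psl3 set" where
  "diag_group t = range (\<lambda>(m, n). diag_elt t m n)"

lemma diag_group_iff: "g \<in> diag_group t \<longleftrightarrow> (\<exists>m n. g = diag_elt t m n)"
  by (auto simp: diag_group_def)

lemma diag_elt_in_diag_group [simp]: "diag_elt t m n \<in> diag_group t"
  by (auto simp: diag_group_iff)

text \<open>One inclusion is an induction over words, since the diagonal elements are closed under
  products. For the other, \<open>x1^m x2^n\<close> maps to the element with exponents
  \<open>m\<close> and \<open>n\<close>.\<close>

lemma range_rep_diag:
  assumes "\<rho> \<in> Rep2" "\<rho> x1 = a_elt t" "\<rho> x2 = b_elt t"
  shows "range \<rho> = diag_group t"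
proof -
  interpret group_hom F2 PSL3 \<rho>
    using assms(1) by unfold_locales (simp add: Rep2_def)
  have inv_letter: "f2_letter (x, False) = inv\<^bsub>F2\<^esub> f2_letter (x, True)" for x
    using F2.inv_equality[of "f2_letter (x, False)" "f2_letter (x, True)"]
      f2_letter_inverse[of "(x, False)"] by simp
  have rho_letter: "\<rho> (f2_letter s) \<in> diag_group t" for s
  proof -
    obtain x e where s: "s = (x, e)" by (cases s)
    then show ?thesis
      by (cases x; cases e)
        (auto simp: diag_group_iff inv_letter hom_inv assms(2,3) a_elt_eq b_elt_eq diag_elt_inv)
  qed
  have "\<rho> \<gamma> \<in> diag_group t" for \<gamma>
  proof (induction \<gamma>)
    case one
    show ?case using hom_one by (simp flip: diag_elt_0[of t])
  next
    case (letter s \<gamma>)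
    obtain m n p q where "\<rho> (f2_letter s) = diag_elt t m n" "\<rho> \<gamma> = diag_elt t p q"
      using rho_letter[of s] letter unfolding diag_group_iff by blast
    then show ?case using hom_mult[of "f2_letter s" \<gamma>] by (simp add: diag_elt_mult)
  qed
  moreover have "diag_elt t m n \<in> range \<rho>" for m n
  proof -
    have "\<rho> (x1 [^]\<^bsub>F2\<^esub> m) = diag_elt t m 0" "\<rho> (x2 [^]\<^bsub>F2\<^esub> n) = diag_elt t 0 n"
      by (simp_all add: hom_int_pow assms(2,3) a_elt_eq b_elt_eq diag_elt_int_pow)
    then have "\<rho> (f2_mult (x1 [^]\<^bsub>F2\<^esub> m) (x2 [^]\<^bsub>F2\<^esub> n)) = diag_elt t m n"
      using hom_mult[of "x1 [^]\<^bsub>F2\<^esub> m" "x2 [^]\<^bsub>F2\<^esub> n"] by (simp add: diag_elt_mult)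
    then show ?thesis by (metis rangeI)
  qed
  ultimately show ?thesis by (auto simp: diag_group_def)
qed

section \<open>Discreteness and failure of virtual cyclicity\<close>

lemma subgroup_diag_group: "subgroup (diag_group t) PSL3"
proof (rule PSL3.subgroupI)
  show "diag_group t \<noteq> {}" by (auto simp: diag_group_def)
  fix x y assume "x \<in> diag_group t" "y \<in> diag_group t"
  then obtain m n p q where "x = diag_elt t m n" "y = diag_elt t p q"
    unfolding diag_group_iff by blast
  then show "inv\<^bsub>PSL3\<^esub> x \<in> diag_group t" "x \<otimes>\<^bsub>PSL3\<^esub> y \<in> diag_group t"
    by (simp_all add: diag_elt_inv diag_elt_mult)
qed simp

lemma discrete_diag_group:
  assumes "t > 0" shows "discrete (diag_group t)"
proof (rule discreteI)
  fix x assume "x \<in> diag_group t"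
  then obtain m n where x: "x = diag_elt t m n" unfolding diag_group_iff by blast
  \<comment> \<open>Windows of half-width \<open>1/2\<close> around the exponents \<open>m\<close>
    and \<open>- n\<close> contain no other integers.\<close>
  let ?T = "{g. exp (t * (m - 1/2)) < entry_norm g 1 1} \<inter> {g. entry_norm g 1 1 < exp (t * (m + 1/2))}
    \<inter> {g. exp (t * (- n - 1/2)) < entry_norm g 3 3} \<inter> {g. entry_norm g 3 3 < exp (t * (- n + 1/2))}"
  show "x isolated_in diag_group t"
  proof (rule isolated_inI)
    show "x \<in> diag_group t" by fact
    show "open ?T"
      by (intro open_Int open_Collect_less continuous_on_const continuous_on_entry_norm)
    have "p = m \<and> q = n" if "diag_elt t p q \<in> ?T" for p q
    proof -
      have "t * (m - 1/2) < t * p" "t * p < t * (m + 1/2)"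
        "t * (- n - 1/2) < t * (- q)" "t * (- q) < t * (- n + 1/2)"
        using that by (simp_all add: entry_norm_diag_elt)
      then have "m - 1/2 < real_of_int p" "p < real_of_int m + 1/2"
        "- n - 1/2 < real_of_int (- q)" "- q < - real_of_int n + 1/2"
        using assms by (simp_all only: mult_less_cancel_left_pos)
      then show ?thesis by linarith
    qed
    moreover have "x \<in> ?T" using assms by (simp add: x entry_norm_diag_elt algebra_simps)
    ultimately show "?T \<inter> diag_group t = {x}"
      using \<open>x \<in> diag_group t\<close> unfolding diag_group_def x by fast
  qed
qed

text \<open>A subgroup of finite index contains a positive power of each generator, but the
  multiples of one vector \<open>(p, q)\<close> cannot meet both coordinate axes of the exponent
  lattice away from the origin.\<close>

lemma diag_group_not_virtually_cyclic:
  assumes "t > 0" shows "\<not> virtually_cyclic (subgp PSL3 (diag_group t))"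
proof
  let ?D = "subgp PSL3 (diag_group t)"
  assume "virtually_cyclic ?D"
  then obtain H where H: "subgroup H ?D" "finite (rcosets\<^bsub>?D\<^esub> H)" "cyclic_group (subgp ?D H)"
    unfolding virtually_cyclic_def finite_index_def by blast
  have H': "subgroup H PSL3"
    using PSL3.incl_subgroup[OF subgroup_diag_group] H(1) by (simp add: subgp_def)
  have sub: "subgp ?D H = PSL3\<lparr>carrier := H\<rparr>" by (simp add: subgp_def)
  interpret HG: group "PSL3\<lparr>carrier := H\<rparr>"
    using subgroup.subgroup_is_group[OF H' group_PSL3] .
  have "H \<subseteq> diag_group t" using subgroup.subset[OF H(1)] by (simp add: subgp_def)
  have carrier_eq: "carrier (PSL3\<lparr>carrier := H\<rparr>) = H" by simp
  obtain h where h: "h \<in> H" "H = range (\<lambda>k::int. h [^]\<^bsub>PSL3\<lparr>carrier := H\<rparr>\<^esub> k)"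
    using H(3) unfolding sub HG.cyclic_group carrier_eq by blast
  have "h \<in> diag_group t" using h(1) \<open>H \<subseteq> diag_group t\<close> by (rule rev_subsetD)
  then obtain p q where hpq: "h = diag_elt t p q" unfolding diag_group_iff by blast
  have H_elt: "\<exists>k. g = diag_elt t (k * p) (k * q)" if "g \<in> H" for g
  proof -
    obtain k :: int where "g = h [^]\<^bsub>PSL3\<lparr>carrier := H\<rparr>\<^esub> k" using \<open>g \<in> H\<close> equalityD1[OF h(2)] by blast
    then have "g = h [^]\<^bsub>PSL3\<^esub> k" using PSL3.int_pow_consistent[OF H' h(1)] by simp
    then show ?thesis unfolding hpq diag_elt_int_pow by blast
  qed
  have pow: "\<exists>k::int. k > 0 \<and> diag_elt t (k * m) (k * n) \<in> H" for m n
  proof -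
    let ?f = "\<lambda>k::nat. H #>\<^bsub>?D\<^esub> diag_elt t (k * m) (k * n)"
    have "range ?f \<subseteq> rcosets\<^bsub>?D\<^esub> H"
    proof -
      have "carrier ?D = diag_group t" by (simp add: subgp_def)
      then show ?thesis
        unfolding RCOSETS_def using diag_elt_in_diag_group by blast
    qed
    then have "\<not> inj ?f" using finite_subset[OF _ H(2)] range_inj_infinite by blast
    then obtain i j :: nat where "i < j" "?f i = ?f j"
      using linorder_injI[of ?f] by blast
    have "psl3_one \<in> H" using subgroup.one_closed[OF H'] by simp
    then have "diag_elt t (j * m) (j * n) \<in> ?f j"
      using PSL3.l_one[of "diag_elt t (j * m) (j * n)"] by (force simp: r_coset_def subgp_def)
    then have "diag_elt t (j * m) (j * n) \<in> ?f i" using \<open>?f i = ?f j\<close> by simp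
    then obtain g where g: "g \<in> H" "diag_elt t (j * m) (j * n) = psl3_mult g (diag_elt t (i * m) (i * n))"
      by (auto simp: r_coset_def subgp_def)
    have "g \<in> diag_group t" using g(1) \<open>H \<subseteq> diag_group t\<close> by (rule rev_subsetD)
    then obtain r s where rs: "g = diag_elt t r s" unfolding diag_group_iff by blast
    have "int j * m = r + int i * m" "int j * n = s + int i * n"
      using g(2) unfolding rs diag_elt_mult diag_elt_eq_iff[OF assms] by auto
    then have "r = (int j - int i) * m" "s = (int j - int i) * n" by (simp_all add: algebra_simps)
    then show ?thesis using g(1) \<open>i < j\<close> rs by (intro exI[of _ "int j - int i"]) auto
  qed
  obtain k l where "k > 0" "diag_elt t k 0 \<in> H" "l > 0" "diag_elt t 0 l \<in> H"
    using pow[of 1 0] pow[of 0 1] by auto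
  then obtain u v where "k = u * p" "0 = u * q" "0 = v * p" "l = v * q"
    using H_elt diag_elt_eq_iff[OF assms] by meson
  \<comment> \<open>Since \<open>k > 0\<close>, the factor \<open>u\<close> is nonzero and
    \<open>0 = u * q\<close> gives \<open>q = 0\<close>, contradicting
    \<open>l = v * q > 0\<close>.\<close>
  then show False using \<open>k > 0\<close> \<open>l > 0\<close> by auto
qed

section \<open>The Kulkarni limit set of the diagonal group\<close>

lemma proj_rel_self [simp]: "proj_rel v v \<longleftrightarrow> v \<noteq> 0"
proof -
  have "v = 1 *s v" by simp
  then show ?thesis unfolding proj_rel_def by blast
qed

lemma abs_cp2_eq_iff:
  assumes "v \<noteq> 0" "w \<noteq> 0"
  shows "abs_cp2 v = abs_cp2 w \<longleftrightarrow> (\<exists>c. v = c *s w)"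
proof -
  have "abs_cp2 w = abs_cp2 v \<longleftrightarrow> proj_rel w v"
    using Quotient3_rel[OF Quotient3_cp2, of w v] assms by simp
  moreover have "proj_rel w v \<longleftrightarrow> (\<exists>c. v = c *s w)"
    unfolding proj_rel_def using assms by blast
  ultimately show ?thesis by metis
qed

lemma cp2_cases [case_names abs, cases type: cp2]:
  obtains v where "v \<noteq> 0" "z = abs_cp2 v"
  using cp2.abs_induct[of "\<lambda>z. \<exists>v. v \<noteq> 0 \<and> z = abs_cp2 v" z] by auto

lemma act_abs: "A \<in> SL3 \<Longrightarrow> v \<noteq> 0 \<Longrightarrow> act (abs_psl3 A) (abs_cp2 v) = abs_cp2 (A *v v)"
  by (simp add: act.abs_eq)

text \<open>Proportionality as the vanishing of all 2 by 2 minors turns equality of projective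
  points into a closed condition.\<close>

lemma parallel_iff:
  fixes v w :: "complex^3"
  assumes "w \<noteq> 0"
  shows "(\<exists>c. v = c *s w) \<longleftrightarrow> (\<forall>i j. v $ i * w $ j = v $ j * w $ i)"
proof
  assume "\<forall>i j. v $ i * w $ j = v $ j * w $ i"
  moreover obtain k where "w $ k \<noteq> 0" using assms by (auto simp: vec_eq_iff)
  ultimately have "v = (v $ k / w $ k) *s w"
    by (simp add: vec_eq_iff field_simps)
  then show "\<exists>c. v = c *s w" by blast
next
  assume "\<exists>c. v = c *s w"
  then obtain c where "v = c *s w" by blast
  then show "\<forall>i j. v $ i * w $ j = v $ j * w $ i" by simp
qed

lemma closed_singleton_cp2: "closed {z :: cp2}"
proof -
  obtain w where w: "w \<noteq> 0" "z = abs_cp2 w" by (metis cp2_cases)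
  have "{v. v \<noteq> 0 \<and> abs_cp2 v \<in> - {z}} = (\<Union>i. \<Union>j. {v. v $ i * w $ j \<noteq> v $ j * w $ i})"
  proof -
    have 1: "abs_cp2 v \<noteq> z \<longleftrightarrow> (\<exists>i j. v $ i * w $ j \<noteq> v $ j * w $ i)" if "v \<noteq> 0" for v
      unfolding w(2) abs_cp2_eq_iff[OF that w(1)] parallel_iff[OF w(1)] by blast
    \<comment> \<open>A nonzero minor already excludes the zero vector, so the union needs no
      separate condition.\<close>
    have 2: "v \<noteq> 0" if "v $ i * w $ j \<noteq> v $ j * w $ i" for v i j
      using that by auto
    have "v \<noteq> 0 \<and> abs_cp2 v \<noteq> z \<longleftrightarrow> (\<exists>i j. v $ i * w $ j \<noteq> v $ j * w $ i)" for v
      using 1 2 by metis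
    then have "{v. v \<noteq> 0 \<and> abs_cp2 v \<in> - {z}} = {v. \<exists>i j. v $ i * w $ j \<noteq> v $ j * w $ i}" by simp
    then show ?thesis by (simp only: Collect_ex_eq)
  qed
  also have "open \<dots>"
    by (intro open_UN ballI open_Collect_neq continuous_intros)
  finally show ?thesis
    unfolding closed_def open_cp2_def .
qed

text \<open>Points are closed, so removing the finitely many points of \<open>S\<close> other than
  \<open>y\<close> from \<open>V\<close> leaves a neighborhood of \<open>y\<close>.\<close>

lemma not_islimpt_finite_Int:
  fixes y :: cp2
  assumes "open V" "y \<in> V" "finite (V \<inter> S)"
  shows "\<not> y islimpt S"
proof
  assume "y islimpt S"
  have "closed (\<Union>z\<in>V \<inter> S - {y}. {z})"
    using assms(3) closed_singleton_cp2 by (intro closed_UN) auto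
  then have "open (V - (V \<inter> S - {y}))" using assms(1) by (auto intro: open_Diff)
  then obtain x where "x \<in> S" "x \<in> V - (V \<inter> S - {y})" "x \<noteq> y"
    using islimptE[OF \<open>y islimpt S\<close>, of "V - (V \<inter> S - {y})"] assms(2) by blast
  then show False by blast
qed

text \<open>As \<open>r\<close> grows, the open sets of \<open>r\<close>-balanced points exhaust the complement of the three
  coordinate lines.\<close>

lift_definition balanced :: "real \<Rightarrow> cp2 \<Rightarrow> bool" is
  "\<lambda>r v. \<forall>i j. cmod (v $ i) < r * cmod (v $ j)"
proof -
  fix r and u v :: "complex^3" assume "proj_rel u v"
  then obtain c where c: "u \<noteq> 0" "v \<noteq> 0" "v = c *s u" unfolding proj_rel_def by blast
  then have "c \<noteq> 0" by auto
  have "cmod (v $ i) < r * cmod (v $ j) \<longleftrightarrow> cmod (u $ i) < r * cmod (u $ j)" for i j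
  proof -
    have "cmod (v $ i) < r * cmod (v $ j) \<longleftrightarrow> cmod c * cmod (u $ i) < cmod c * (r * cmod (u $ j))"
      by (simp add: c(3) norm_mult mult_ac)
    also have "\<dots> \<longleftrightarrow> cmod (u $ i) < r * cmod (u $ j)"
      using \<open>c \<noteq> 0\<close> by (intro mult_less_cancel_left_pos) simp
    finally show ?thesis .
  qed
  then show "(\<forall>i j. cmod (u $ i) < r * cmod (u $ j)) = (\<forall>i j. cmod (v $ i) < r * cmod (v $ j))"
    by simp
qed

lemma balanced_abs: "v \<noteq> 0 \<Longrightarrow> balanced r (abs_cp2 v) \<longleftrightarrow> (\<forall>i j. cmod (v $ i) < r * cmod (v $ j))"
  by (simp add: balanced.abs_eq)

lemma open_balanced: "open {z. balanced r z}"
proof -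
  have "{v. v \<noteq> 0 \<and> abs_cp2 v \<in> {z. balanced r z}} =
      - {0} \<inter> (\<Inter>i. \<Inter>j. {v. cmod (v $ i) < r * cmod (v $ j)})"
    by (auto simp: balanced_abs)
  moreover have "open \<dots>"
    by (intro open_Int open_INT ballI open_Collect_less continuous_intros) auto
  ultimately show ?thesis unfolding open_cp2_def by simp
qed

lemma balanced_mono: "balanced r z \<Longrightarrow> r \<le> s \<Longrightarrow> balanced s z"
proof (cases z)
  case (abs v)
  assume r: "balanced r z" "r \<le> s"
  have "cmod (v $ i) < s * cmod (v $ j)" for i j
  proof -
    have "cmod (v $ i) < r * cmod (v $ j)" using r(1) abs by (simp add: balanced_abs)
    also have "\<dots> \<le> s * cmod (v $ j)" using r(2) by (simp add: mult_right_mono)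
    finally show ?thesis .
  qed
  then show ?thesis using abs by (simp add: balanced_abs)
qed

lemma act_diag_elt:
  assumes "v \<noteq> 0"
  shows "act (diag_elt t m n) (abs_cp2 v) = abs_cp2 (vector [of_real (exp (t * m)) * v $ 1,
    of_real (exp (t * (n - m))) * v $ 2, of_real (exp (- t * n)) * v $ 3])"
proof -
  have "diag3 (of_real (exp (t * m))) (of_real (exp (t * (n - m)))) (of_real (exp (- t * n))) \<in> SL3"
    by simp
  then show ?thesis unfolding diag_elt_def by (simp only: act_abs assms not_False_eq_True diag3_mult_vec)
qed

text \<open>The strict inequality at equal indices forces the radius to exceed \<open>1\<close>; any
  such radius would do, and \<open>2\<close> is taken.\<close>

lemma balanced_1: "balanced 2 (abs_cp2 1)"
proof -
  have "(1 :: complex^3) \<noteq> 0" by simp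
  then show ?thesis by (subst balanced_abs) simp_all
qed

section \<open>Stabilizers and proper discontinuity of the diagonal group\<close>

text \<open>A point balanced for no radius has a vanishing coordinate. Infinitely many diagonal
  elements scale the other two coordinates by a common factor and so fix the point.\<close>

lemma infinite_stabilizer:
  assumes "t > 0" "\<And>r. \<not> balanced r z"
  shows "infinite {g \<in> diag_group t. act g z = z}"
proof (cases z)
  case (abs v)
  obtain k where k: "v $ k = 0"
  proof (rule ccontr)
    assume "\<not> thesis"
    then have nz: "v $ i \<noteq> 0" for i using that by blast
    \<comment> \<open>Adding \<open>1\<close> to the sum of all coordinate ratios gives a radius
      strictly above each of them.\<close>
    let ?R = "1 + (\<Sum>i\<in>UNIV. \<Sum>j\<in>UNIV. cmod (v $ i) / cmod (v $ j))"
    have "cmod (v $ i) / cmod (v $ j) < ?R" for i j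
    proof -
      have "cmod (v $ i) / cmod (v $ j) \<le> (\<Sum>j\<in>UNIV. cmod (v $ i) / cmod (v $ j))"
        by (rule member_le_sum) auto
      also have "\<dots> \<le> (\<Sum>i\<in>UNIV. \<Sum>j\<in>UNIV. cmod (v $ i) / cmod (v $ j))"
        by (rule member_le_sum) (auto intro: sum_nonneg)
      finally show ?thesis by simp
    qed
    then have "balanced ?R z" using nz abs by (simp add: balanced_abs divide_simps)
    then show False using assms(2) by blast
  qed
  \<comment> \<open>A nonzero direction \<open>(a, b)\<close> in the exponent lattice whose
    multiples all fix \<open>z\<close> suffices.\<close>
  have *: "infinite {g \<in> diag_group t. act g z = z}"
    if f: "\<And>n::int. act (diag_elt t (a * n) (b * n)) z = z" and ab: "a \<noteq> 0 \<or> b \<noteq> 0" for a b :: int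
  proof -
    have "inj (\<lambda>n. diag_elt t (a * n) (b * n))"
      using ab by (auto simp: inj_def diag_elt_eq_iff[OF assms(1)])
    then have "infinite (range (\<lambda>n. diag_elt t (a * n) (b * n)))"
      using finite_imageD infinite_UNIV_int by blast
    moreover have "range (\<lambda>n. diag_elt t (a * n) (b * n)) \<subseteq> {g \<in> diag_group t. act g z = z}"
      using f by auto
    ultimately show ?thesis using finite_subset by blast
  qed
  have scale: "act (diag_elt t m n) z = z"
    if "vector [of_real (exp (t * m)) * v $ 1, of_real (exp (t * (n - m))) * v $ 2,
        of_real (exp (- t * n)) * v $ 3] = complex_of_real (exp s) *s v" for m n :: int and s
  proof -
    have "complex_of_real (exp s) *s v \<noteq> 0" using abs(1) by (simp add: vec_eq_iff)
    then have "abs_cp2 (complex_of_real (exp s) *s v) = abs_cp2 v"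
      using abs(1) abs_cp2_eq_iff by blast
    then show ?thesis using abs act_diag_elt that by metis
  qed
  \<comment> \<open>In each case the direction makes the exponents of the two remaining coordinates
    equal, among \<open>m\<close>, \<open>n - m\<close> and \<open>- n\<close>.\<close>
  consider "k = 1" | "k = 2" | "k = 3" using exhaust_3 by blast
  then show ?thesis
  proof cases
    case 1
    have "act (diag_elt t (2 * n) (1 * n)) z = z" for n
      by (rule scale[of _ _ "- t * n"]) (use k 1 in \<open>simp add: vec_eq_iff forall_3 algebra_simps\<close>)
    then show ?thesis by (intro *[of 2 1]) auto
  next
    case 2
    have "act (diag_elt t (1 * n) ((- 1) * n)) z = z" for n
      by (rule scale[of _ _ "t * n"]) (use k 2 in \<open>simp add: vec_eq_iff forall_3 algebra_simps\<close>)
    then show ?thesis by (intro *[of 1 "- 1"]) auto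
  next
    case 3
    have "act (diag_elt t (1 * n) (2 * n)) z = z" for n
      by (rule scale[of _ _ "t * n"]) (use k 3 in \<open>simp add: vec_eq_iff forall_3 algebra_simps\<close>)
    then show ?thesis by (intro *[of 1 2]) auto
  qed
qed

text \<open>The ratios of the coordinates of a point and of its image bound both exponents of a
  diagonal element.\<close>

lemma finite_balanced_transporter:
  assumes "t > 0"
  shows "finite {g \<in> diag_group t. \<exists>z. balanced r z \<and> balanced s (act g z)}"
proof -
  define N where "N = \<lceil>ln (r * s) / t\<rceil>"
  have "{g \<in> diag_group t. \<exists>z. balanced r z \<and> balanced s (act g z)}
      \<subseteq> (\<lambda>(m, n). diag_elt t m n) ` ({- N..N} \<times> {- N..N})"
  proof (rule subsetI)
    fix g assume "g \<in> {g \<in> diag_group t. \<exists>z. balanced r z \<and> balanced s (act g z)}"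
    then obtain z where "g \<in> diag_group t" and z: "balanced r z" "balanced s (act g z)" by blast
    obtain m n where g: "g = diag_elt t m n" using \<open>g \<in> diag_group t\<close> unfolding diag_group_iff by blast
    obtain v where v: "v \<noteq> 0" "z = abs_cp2 v" by (metis cp2_cases)
    define w :: "complex^3" where "w = vector [of_real (exp (t * m)) * v $ 1,
      of_real (exp (t * (n - m))) * v $ 2, of_real (exp (- t * n)) * v $ 3]"
    \<comment> \<open>The exponent vector of \<open>g\<close>, so that all three coordinates are
      treated uniformly.\<close>
    define e where "e = (\<lambda>i::3. if i = 1 then m else if i = 2 then n - m else - n)"
    have w_nth: "w $ i = of_real (exp (t * e i)) * v $ i" for i
      using exhaust_3[of i] by (auto simp: w_def e_def)
    have v_less: "cmod (v $ i) < r * cmod (v $ j)" for i j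
      using z(1) v by (simp add: balanced_abs)
    \<comment> \<open>Equal indices in the strict inequality rule out a zero coordinate.\<close>
    have nz: "v $ i \<noteq> 0" for i
    proof
      assume "v $ i = 0"
      then show False using v_less[of i i] by simp
    qed
    then have "w \<noteq> 0" using w_nth[of 1] by auto
    moreover have "act g z = abs_cp2 w"
      unfolding g v(2) w_def by (rule act_diag_elt[OF v(1)])
    ultimately have w_less: "cmod (w $ i) < s * cmod (w $ j)" for i j
      using z(2) by (simp add: balanced_abs)
    have "e i - e j \<le> N" for i j
    proof -
      have "0 < r * cmod (v $ j)" "0 < s * cmod (w $ i)"
        using v_less w_less le_less_trans norm_ge_zero by blast+
      then have "r > 0" "s > 0" by (simp_all add: zero_less_mult_iff)
      \<comment> \<open>Balance of the image compares coordinates \<open>i\<close> and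
        \<open>j\<close> of \<open>w\<close>; balance of the point returns from \<open>j\<close> to
        \<open>i\<close>, after which the modulus of \<open>v $ i\<close> cancels.\<close>
      have "exp (t * e i) * cmod (v $ i) < s * (exp (t * e j) * cmod (v $ j))"
        using w_less[of i j] by (simp add: w_nth norm_mult)
      also have "\<dots> < s * (exp (t * e j) * (r * cmod (v $ i)))"
        using v_less \<open>s > 0\<close> by simp
      also have "\<dots> = (s * exp (t * e j) * r) * cmod (v $ i)" by simp
      finally have "exp (t * e i) < s * exp (t * e j) * r"
        using nz by (simp add: mult_less_cancel_right)
      then have "exp (t * (e i - e j)) < r * s"
        by (simp add: right_diff_distrib exp_diff field_simps)
      then have "t * (e i - e j) < ln (r * s)"
        using \<open>r > 0\<close> \<open>s > 0\<close> by (metis exp_gt_zero ln_exp ln_less_cancel_iff mult_pos_pos)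
      then have "real_of_int (e i - e j) < ln (r * s) / t"
        using assms by (simp add: field_simps)
      then show ?thesis unfolding N_def by linarith
    qed
    from this[of 1 2] this[of 2 1] this[of 2 3] this[of 3 2]
    have "2 * m - n \<le> N" "n - 2 * m \<le> N" "2 * n - m \<le> N" "m - 2 * n \<le> N"
      by (simp_all add: e_def)
    \<comment> \<open>Here \<open>3 * m = 2 * (2 * m - n) + (2 * n - m)\<close>, and symmetrically
      for \<open>n\<close>.\<close>
    then have "m \<in> {- N..N}" "n \<in> {- N..N}" unfolding atLeastAtMost_iff by linarith+
    then show "g \<in> (\<lambda>(m, n). diag_elt t m n) ` ({- N..N} \<times> {- N..N})"
      unfolding g by force
  qed
  then show ?thesis by (rule finite_subset) simp
qed

text \<open>The balanced sets are open and increase with the radius, so a finite subcover is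
  absorbed by its largest member.\<close>

lemma compact_balanced:
  assumes "compact K" "\<And>z. z \<in> K \<Longrightarrow> \<exists>r. balanced r z"
  obtains r where "\<And>z. z \<in> K \<Longrightarrow> balanced r z"
proof -
  have "K \<subseteq> (\<Union>r. {z. balanced r z})" using assms(2) by auto
  then obtain D where D: "finite D" "K \<subseteq> (\<Union>r\<in>D. {z. balanced r z})"
    using compactE_image[OF assms(1), of UNIV "\<lambda>r. {z. balanced r z}"] open_balanced by metis
  \<comment> \<open>Inserting \<open>0\<close> keeps the maximum defined when \<open>D\<close> is
    empty.\<close>
  have "balanced (Max (insert 0 D)) z" if "z \<in> K" for z
  proof -
    obtain r where "r \<in> D" "balanced r z" using D(2) \<open>z \<in> K\<close> by blast
    have "r \<le> Max (insert 0 D)" using D(1) \<open>r \<in> D\<close> by simp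
    with \<open>balanced r z\<close> show ?thesis by (rule balanced_mono)
  qed
  then show thesis by (rule that)
qed

text \<open>The open set \<open>?V\<close> misses all three pieces of the limit set. Openness lets
  the closures be ignored, and each piece is excluded by finiteness of the elements carrying
  balanced points to balanced points.\<close>

lemma kul_domain_diag_group:
  assumes "t > 0"
  shows "abs_cp2 1 \<in> kul_domain (diag_group t)"
proof -
  let ?G = "diag_group t" and ?V = "{z. balanced 2 z}"
  have L0: "\<exists>r. balanced r z" if "z \<notin> kul_L0 ?G" for z
  proof (rule ccontr)
    assume "\<not> (\<exists>r. balanced r z)"
    then have "infinite {g \<in> ?G. act g z = z}" using infinite_stabilizer[OF assms] by blast
    then have "z \<in> kul_L0 ?G"
      unfolding kul_L0_def by (intro subsetD[OF closure_subset] CollectI)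
    then show False using that by contradiction
  qed
  have "?V \<inter> {z. infinite {g \<in> ?G. act g z = z}} = {}"
  proof -
    have "finite {g \<in> ?G. act g z = z}" if "balanced 2 z" for z
      by (rule finite_subset[OF _ finite_balanced_transporter[OF assms, of 2 2]]) (use that in auto)
    then show ?thesis by blast
  qed
  then have V0: "?V \<inter> kul_L0 ?G = {}"
    unfolding kul_L0_def open_Int_closure_eq_empty[OF open_balanced] .
  have "\<not> y islimpt ((\<lambda>g. act g z) ` ?G)" if y: "balanced 2 y" and z: "z \<notin> kul_L0 ?G" for y z
  proof (rule not_islimpt_finite_Int[OF open_balanced])
    show "y \<in> ?V" using y by simp
    obtain r where "balanced r z" using L0[OF z] by blast
    then have "?V \<inter> (\<lambda>g. act g z) ` ?G \<subseteq>
        (\<lambda>g. act g z) ` {g \<in> ?G. \<exists>z. balanced r z \<and> balanced 2 (act g z)}" by blast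
    then show "finite (?V \<inter> (\<lambda>g. act g z) ` ?G)"
      using finite_balanced_transporter[OF assms] finite_surj by blast
  qed
  then have V1: "?V \<inter> kul_L1 ?G = {}"
    unfolding kul_L1_def open_Int_closure_eq_empty[OF open_balanced] by blast
  have "y \<notin> family_accumulation ?G K"
    if y: "balanced 2 y" and K: "compact K" "K \<inter> (kul_L0 ?G \<union> kul_L1 ?G) = {}" for y K
  proof -
    \<comment> \<open>Points outside \<open>kul_L0\<close> are balanced, and compactness provides
      one radius for all of \<open>K\<close>.\<close>
    obtain r where r: "\<And>z. z \<in> K \<Longrightarrow> balanced r z"
      using compact_balanced[OF K(1)] L0 K(2) by blast
    have "{g \<in> ?G. act g ` K \<inter> ?V \<noteq> {}} \<subseteq> {g \<in> ?G. \<exists>z. balanced r z \<and> balanced 2 (act g z)}"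
      using r by blast
    then have "finite {g \<in> ?G. act g ` K \<inter> ?V \<noteq> {}}"
      using finite_balanced_transporter[OF assms] finite_subset by blast
    then show ?thesis using open_balanced y unfolding family_accumulation_def by blast
  qed
  then have V2: "?V \<inter> kul_L2 ?G = {}"
    unfolding kul_L2_def open_Int_closure_eq_empty[OF open_balanced] by blast
  show ?thesis
    using V0 V1 V2 balanced_1 unfolding kul_domain_def kul_limit_def by blast
qed

section \<open>The diagonal representation as a counterexample to density\<close>

lemma diag_rep_in_K2:
  assumes "t > 0" "\<rho> \<in> Rep2" "\<rho> x1 = a_elt t" "\<rho> x2 = b_elt t"
  shows "\<rho> \<in> K2"
proof -
  have "complex_kleinian (diag_group t)"
    unfolding complex_kleinian_def discrete_subgroup_def
    using subgroup_diag_group discrete_diag_group[OF assms(1)] kul_domain_diag_group[OF assms(1)]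
    by (intro conjI) auto
  then show ?thesis
    unfolding K2_def using assms(2) diag_group_not_virtually_cyclic[OF assms(1)]
    by (simp add: range_rep_diag[OF assms(2-4)])
qed

theorem corollary6p3:
  fixes U :: "psl3 set" and t :: real and \<rho>\<^sub>0 :: "f2 \<Rightarrow> psl3"
    and \<U>\<^sub>2 :: "(f2 \<Rightarrow> psl3) set"
  assumes "zassenhaus_nbhd U"
    and "t > 0" and "a_elt t \<in> U" and "b_elt t \<in> U"
    and "\<rho>\<^sub>0 \<in> Rep2" and "\<rho>\<^sub>0 x1 = a_elt t" and "\<rho>\<^sub>0 x2 = b_elt t"
    and "schottky_locus \<U>\<^sub>2"
  shows "\<not> (\<exists>\<rho> :: nat \<Rightarrow> f2 \<Rightarrow> psl3. (\<forall>j. \<rho> j \<in> \<U>\<^sub>2) \<and> alg_converges \<rho> \<rho>\<^sub>0)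
    \<and> zariski_dense \<U>\<^sub>2
    \<and> \<not> dense_in_K2 \<U>\<^sub>2"
proof -
  have S: "\<U>\<^sub>2 \<noteq> {}" "open_Rep2 \<U>\<^sub>2"
    using assms(8) by (simp_all add: schottky_locus_def)
  then have "\<U>\<^sub>2 \<subseteq> Rep2" by (simp add: open_Rep2_def)
  have elts: "inj \<rho>" "discrete_subgroup (range \<rho>)" if "\<rho> \<in> \<U>\<^sub>2" for \<rho>
    using assms(8) that by (simp_all add: schottky_locus_def complex_kleinian_def)
  have "\<not> (\<exists>\<rho>. (\<forall>j. \<rho> j \<in> \<U>\<^sub>2) \<and> alg_converges \<rho> \<rho>\<^sub>0)"
  proof (intro notI, elim exE conjE)
    fix \<rho> assume \<rho>: "\<forall>j. \<rho> j \<in> \<U>\<^sub>2" "alg_converges \<rho> \<rho>\<^sub>0"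
    have "\<not> alg_converges \<rho> \<rho>\<^sub>0"
    proof (rule zassenhaus_not_converges[OF assms(1)])
      show "\<rho>\<^sub>0 x1 \<in> U" "\<rho>\<^sub>0 x2 \<in> U" using assms(3,4,6,7) by simp_all
      show "\<rho> j \<in> Rep2" "inj (\<rho> j)" "discrete_subgroup (range (\<rho> j))" for j
        using \<rho>(1) elts \<open>\<U>\<^sub>2 \<subseteq> Rep2\<close> by blast+
    qed
    with \<rho>(2) show False by contradiction
  qed
  \<comment> \<open>Density would supply a sequence converging to this element of \<open>K2\<close>,
    which has just been excluded.\<close>
  moreover have "\<rho>\<^sub>0 \<in> K2" using diag_rep_in_K2 assms(2,5,6,7) by blast
  ultimately show ?thesis using zariski_dense_open[OF S(2,1)] unfolding dense_in_K2_def by blast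
qed

end
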